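(* On $S^3$ there exists a sequence $\big((g_l(t))_{t\in[0,T(l))}\big)_{l\in\mathbb N}$ of homogeneous Ricci flow solutions with $\Vert\mathrm{Rm}(g_l(0))\Vert=1$, $\mathrm{scal}(g_l(0))>0$ for all $l$, and $T(l)\to\infty$ as $l\to\infty$.
   Context: A Ricci flow solution satisfies $\partial_tg(t)=-2\,\mathrm{Ric}(g(t))$; it is homogeneous if for each $t$ the isometry group of $g(t)$ acts transitively. $T(l)\in(0,\infty)$ denotes the extinction time, i.e. $[0,T(l))$ is the maximal forward interval of existence of $g_l(t)$. $\mathrm{Rm}$ is the Riemannian curvature tensor and $\mathrm{scal}$ the scalar curvature; for homogeneous metrics $\Vert\mathrm{Rm}\Vert$ and $\mathrm{scal}$ are constant functions on the manifold, identified with real numbers. *)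

theory Defs
  imports "HOL-Analysis.Analysis"
begin

section \<open>Smooth maps\<close>

primrec Ck_on :: "nat \<Rightarrow> ('a::euclidean_space \<Rightarrow> 'b::real_normed_vector) \<Rightarrow> 'a set \<Rightarrow> bool" where
  "Ck_on 0 f U \<longleftrightarrow> continuous_on U f"
| "Ck_on (Suc k) f U \<longleftrightarrow>
     (\<exists>f'. (\<forall>x\<in>U. (f has_derivative f' x) (at x)) \<and> (\<forall>v. Ck_on k (\<lambda>x. f' x v) U))"

text \<open>
  Smoothness on an arbitrary subset of a Euclidean space: local existence of \<open>C\<^sup>\<infinity>\<close> extensions.
  On an embedded submanifold, with or without boundary, this is the usual intrinsic notion.
\<close>

definition smooth_on :: "'a::euclidean_space set \<Rightarrow> ('a \<Rightarrow> 'b::real_normed_vector) \<Rightarrow> bool" where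
  "smooth_on A f \<longleftrightarrow>
     (\<forall>x\<in>A. \<exists>U F. open U \<and> x \<in> U \<and> (\<forall>k. Ck_on k F U) \<and> (\<forall>y\<in>A \<inter> U. F y = f y))"


section \<open>The three-sphere\<close>

text \<open>
  The three-sphere is the unit sphere of \<open>real ^ 4\<close>, and its tangent space at \<open>p\<close> is the orthogonal
  complement of \<open>p\<close>. Functions, vector fields and metrics on the sphere are total functions on
  \<open>real ^ 4\<close>; only their values at points of the sphere (and on tangent vectors) matter.
\<close>

type_synonym R4 = "real ^ 4"

abbreviation S3 :: "R4 set" where
  "S3 \<equiv> sphere 0 1"

definition tangent_space :: "R4 \<Rightarrow> R4 set" where
  "tangent_space p = {v. v \<bullet> p = 0}"

text \<open>
  The differential at \<open>p\<close> of a map on the sphere, applied to a tangent vector \<open>v\<close>. The map is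
  first extended to a neighbourhood of the sphere by radial projection, so that values of \<open>f\<close>
  outside the sphere are irrelevant.
\<close>

definition dS3 :: "(R4 \<Rightarrow> 'b::real_normed_vector) \<Rightarrow> R4 \<Rightarrow> R4 \<Rightarrow> 'b" where
  "dS3 f p v = frechet_derivative (\<lambda>x. f (x /\<^sub>R norm x)) (at p) v"

type_synonym vfield = "R4 \<Rightarrow> R4"

definition vector_fields :: "vfield set" where
  "vector_fields = {X. smooth_on S3 X \<and> (\<forall>p\<in>S3. X p \<in> tangent_space p)}"

text \<open>
  The \<open>i\<close>-th component is \<open>X(Y x\<^sub>i) - Y(X x\<^sub>i)\<close> for the coordinate function \<open>x\<^sub>i\<close> on
  \<open>real ^ 4\<close>.
\<close>

definition lie_bracket :: "vfield \<Rightarrow> vfield \<Rightarrow> vfield" where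
  "lie_bracket X Y = (\<lambda>p. dS3 Y p (X p) - dS3 X p (Y p))"


section \<open>Riemannian metrics, Levi-Civita connection and curvature\<close>

type_synonym metric = "R4 \<Rightarrow> R4 \<Rightarrow> R4 \<Rightarrow> real"

definition inner_product_on :: "R4 set \<Rightarrow> (R4 \<Rightarrow> R4 \<Rightarrow> real) \<Rightarrow> bool" where
  "inner_product_on V b \<longleftrightarrow>
     (\<forall>u\<in>V. \<forall>v\<in>V. b u v = b v u) \<and>
     (\<forall>u\<in>V. \<forall>v\<in>V. \<forall>w\<in>V. \<forall>a c. b (a *\<^sub>R u + c *\<^sub>R v) w = a * b u w + c * b v w) \<and>
     (\<forall>u\<in>V. u \<noteq> 0 \<longrightarrow> b u u > 0)"

definition riemannian_metric :: "metric \<Rightarrow> bool" where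
  "riemannian_metric g \<longleftrightarrow>
     (\<forall>p\<in>S3. inner_product_on (tangent_space p) (g p)) \<and>
     (\<forall>X\<in>vector_fields. \<forall>Y\<in>vector_fields. smooth_on S3 (\<lambda>p. g p (X p) (Y p)))"

definition affine_connection :: "(vfield \<Rightarrow> vfield \<Rightarrow> vfield) \<Rightarrow> bool" where
  "affine_connection D \<longleftrightarrow>
     (\<forall>X\<in>vector_fields. \<forall>Y\<in>vector_fields. D X Y \<in> vector_fields) \<and>
     (\<forall>X\<in>vector_fields. \<forall>Y\<in>vector_fields. \<forall>Z\<in>vector_fields. \<forall>p\<in>S3.
        D (\<lambda>q. X q + Y q) Z p = D X Z p + D Y Z p \<and>
        D X (\<lambda>q. Y q + Z q) p = D X Y p + D X Z p) \<and>
     (\<forall>f::R4 \<Rightarrow> real. smooth_on S3 f \<longrightarrow>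
        (\<forall>X\<in>vector_fields. \<forall>Y\<in>vector_fields. \<forall>p\<in>S3.
           D (\<lambda>q. f q *\<^sub>R X q) Y p = f p *\<^sub>R D X Y p \<and>
           D X (\<lambda>q. f q *\<^sub>R Y q) p = dS3 f p (X p) *\<^sub>R Y p + f p *\<^sub>R D X Y p))"

definition is_levi_civita :: "metric \<Rightarrow> (vfield \<Rightarrow> vfield \<Rightarrow> vfield) \<Rightarrow> bool" where
  "is_levi_civita g D \<longleftrightarrow> affine_connection D \<and>
     (\<forall>X\<in>vector_fields. \<forall>Y\<in>vector_fields. \<forall>p\<in>S3.
        D X Y p - D Y X p = lie_bracket X Y p) \<and>
     (\<forall>X\<in>vector_fields. \<forall>Y\<in>vector_fields. \<forall>Z\<in>vector_fields. \<forall>p\<in>S3.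
        dS3 (\<lambda>q. g q (Y q) (Z q)) p (X p) = g p (D X Y p) (Z p) + g p (Y p) (D X Z p))"

text \<open>
  By the fundamental theorem of Riemannian geometry, such a connection exists and its values on the
  sphere are unique, so the choice is immaterial.
\<close>

definition levi_civita :: "metric \<Rightarrow> vfield \<Rightarrow> vfield \<Rightarrow> vfield" where
  "levi_civita g = (SOME D. is_levi_civita g D)"

definition curvature_op :: "metric \<Rightarrow> vfield \<Rightarrow> vfield \<Rightarrow> vfield \<Rightarrow> vfield" where
  "curvature_op g X Y Z =
     (let D = levi_civita g
      in (\<lambda>p. D X (D Y Z) p - D Y (D X Z) p - D (lie_bracket X Y) Z p))"

text \<open>
  A vector field with value \<open>u\<close> at \<open>p\<close>, for \<open>u\<close> tangent at \<open>p\<close>. Since the curvature is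
  tensorial, it may be evaluated on tangent vectors through any such extension.
\<close>

definition extend_tangent :: "R4 \<Rightarrow> vfield" where
  "extend_tangent u = (\<lambda>x. u - (u \<bullet> x) *\<^sub>R x)"

definition Rm :: "metric \<Rightarrow> R4 \<Rightarrow> R4 \<Rightarrow> R4 \<Rightarrow> R4 \<Rightarrow> R4 \<Rightarrow> real" where
  "Rm g p u v w z =
     g p (curvature_op g (extend_tangent u) (extend_tangent v) (extend_tangent w) p) z"

definition orthonormal_frame :: "metric \<Rightarrow> R4 \<Rightarrow> (3 \<Rightarrow> R4) \<Rightarrow> bool" where
  "orthonormal_frame g p e \<longleftrightarrow>
     (\<forall>i. e i \<in> tangent_space p) \<and> (\<forall>i j. g p (e i) (e j) = (if i = j then 1 else 0))"

text \<open>
  The contractions below do not depend on the orthonormal basis. With the index convention chosen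
  here, round metrics have positive Ricci curvature.
\<close>

definition frame_at :: "metric \<Rightarrow> R4 \<Rightarrow> 3 \<Rightarrow> R4" where
  "frame_at g p = (SOME e. orthonormal_frame g p e)"

definition Ric :: "metric \<Rightarrow> R4 \<Rightarrow> R4 \<Rightarrow> R4 \<Rightarrow> real" where
  "Ric g p v w = (let e = frame_at g p in \<Sum>i\<in>UNIV. Rm g p (e i) v w (e i))"

definition scal :: "metric \<Rightarrow> R4 \<Rightarrow> real" where
  "scal g p = (let e = frame_at g p in \<Sum>i\<in>UNIV. Ric g p (e i) (e i))"

definition Rm_norm :: "metric \<Rightarrow> R4 \<Rightarrow> real" where
  "Rm_norm g p = (let e = frame_at g p in
     sqrt (\<Sum>i\<in>UNIV. \<Sum>j\<in>UNIV. \<Sum>k\<in>UNIV. \<Sum>l\<in>UNIV. (Rm g p (e i) (e j) (e k) (e l))\<^sup>2))"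


section \<open>Homogeneous metrics\<close>

definition diffeomorphism :: "(R4 \<Rightarrow> R4) \<Rightarrow> bool" where
  "diffeomorphism \<phi> \<longleftrightarrow>
     bij_betw \<phi> S3 S3 \<and> smooth_on S3 \<phi> \<and> smooth_on S3 (inv_into S3 \<phi>)"

definition isometries :: "metric \<Rightarrow> (R4 \<Rightarrow> R4) set" where
  "isometries g = {\<phi>. diffeomorphism \<phi> \<and>
     (\<forall>p\<in>S3. \<forall>u\<in>tangent_space p. \<forall>v\<in>tangent_space p.
        g (\<phi> p) (dS3 \<phi> p u) (dS3 \<phi> p v) = g p u v)}"

definition homogeneous :: "metric \<Rightarrow> bool" where
  "homogeneous g \<longleftrightarrow> (\<forall>p\<in>S3. \<forall>q\<in>S3. \<exists>\<phi>\<in>isometries g. \<phi> p = q)"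


section \<open>Ricci flow\<close>

text \<open>
  A smooth family of metrics on \<open>[0,T)\<close>, smooth in time and space jointly and up to the initial
  time, solving the Ricci flow equation (with the one-sided time derivative at time \<open>0\<close>).
\<close>

definition ricci_flow :: "real \<Rightarrow> (real \<Rightarrow> metric) \<Rightarrow> bool" where
  "ricci_flow T g \<longleftrightarrow>
     (\<forall>t\<in>{0..<T}. riemannian_metric (g t)) \<and>
     (\<forall>X\<in>vector_fields. \<forall>Y\<in>vector_fields.
        smooth_on ({0..<T} \<times> S3) (\<lambda>(t, p). g t p (X p) (Y p))) \<and>
     (\<forall>t\<in>{0..<T}. \<forall>p\<in>S3. \<forall>u\<in>tangent_space p. \<forall>v\<in>tangent_space p.
        ((\<lambda>s. g s p u v) has_real_derivative (- 2 * Ric (g t) p u v)) (at t within {0..<T}))"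

definition homogeneous_ricci_flow :: "real \<Rightarrow> (real \<Rightarrow> metric) \<Rightarrow> bool" where
  "homogeneous_ricci_flow T g \<longleftrightarrow> ricci_flow T g \<and> (\<forall>t\<in>{0..<T}. homogeneous (g t))"

definition extinction_time :: "(real \<Rightarrow> metric) \<Rightarrow> real \<Rightarrow> bool" where
  "extinction_time g T \<longleftrightarrow> 0 < T \<and> ricci_flow T g \<and>
     \<not> (\<exists>T'>T. \<exists>h. ricci_flow T' h \<and>
          (\<forall>t\<in>{0..<T}. \<forall>p\<in>S3. \<forall>u\<in>tangent_space p. \<forall>v\<in>tangent_space p. h t p u v = g t p u v))"

end

theory Submission
  imports Defs
begin

text \<open>
  The sphere is the group of unit quaternions, and only left-invariant metrics that are diagonal in
  the frame \<open>p * i\<close>, \<open>p * j\<close>, \<open>p * k\<close> are needed. Let \<open>a$1\<close>, \<open>a$2\<close>, \<open>a$3\<close> be the squared lengths of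
  these fields. Such a metric is homogeneous because left translations are isometries and act
  transitively. Its Christoffel symbols in the frame are constants, so its curvature is an explicit
  rational expression in the squared lengths (\<open>Rm_left_metric\<close>, \<open>Ric_left_metric\<close>, \<open>scal_left_metric\<close>,
  \<open>Rm_norm_left_metric\<close>). The Ricci tensor is again diagonal, and the flow becomes
  \<open>(a$1)' = - 4 * ((a$1)^2 - (a$2 - a$3)^2) / (a$2 * a$3)\<close> and its cyclic permutations
  (\<open>ricci_flow_left_metric\<close>).

  The initial metrics are proportional to \<open>(1, 1 - e, e^2)\<close> with \<open>e\<close> tending to 0. The third direction
  is very short and the two long ones have nearly equal length, as in the flat left-invariant
  metrics on the group of motions of the Euclidean plane, where the long lengths are equal. The
  curvature comes mostly from the mismatch \<open>e\<close> of the long directions, and its norm is of order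
  \<open>1 / e\<close>; normalizing it to 1 stretches the metric by a factor \<open>r\<close> of order \<open>1 / e\<close>. The choice of
  \<open>e^2\<close> for the short direction is what keeps the scalar curvature positive. Under the flow the
  mismatch disappears before the rest of the shape moves. After that the metric is
  close to a large Berger sphere with a tiny fibre, over a two-sphere whose squared radius is of
  order \<open>r\<close>, and it lives for a time of order \<open>r\<close>. The rigorous form of this heuristic is a monotone
  quantity (\<open>left_ricci_flow_exists\<close>), which gives a lifetime of at least a constant multiple of \<open>1 / e\<close>.

  To obtain the solutions up to the extinction time, the flow is split into shape and size. After a
  change of time the shape obeys an equation that has solutions for all time. The size decays
  exponentially and the original time has a finite limit \<open>T\<close>, so the
  metrics tend to zero as \<open>t\<close> tends to \<open>T\<close>. No Ricci flow, homogeneous or not, can continue them, since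
  its metric at time \<open>T\<close> would be the zero form (\<open>extinction_time_left_metric\<close>).
\<close>

section \<open>Calculus of smooth maps\<close>

lemma Ck_on_cong:
  assumes "Ck_on k f U" "open U" "\<And>x. x \<in> U \<Longrightarrow> f x = g x"
  shows "Ck_on k g U"
proof (cases k)
  case 0
  then show ?thesis using assms by (auto cong: continuous_on_cong)
next
  case (Suc m)
  then obtain f' where f': "\<forall>x\<in>U. (f has_derivative f' x) (at x)" "\<forall>v. Ck_on m (\<lambda>x. f' x v) U"
    using assms(1) by auto
  have "(g has_derivative f' x) (at x)" if "x \<in> U" for x
    using f'(1) that assms(2,3) has_derivative_transform_within_open by blast
  then show ?thesis using Suc f'(2) by auto
qed

lemma Ck_on_subset: "Ck_on k f U \<Longrightarrow> V \<subseteq> U \<Longrightarrow> Ck_on k f V"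
proof (induction k arbitrary: f)
  case 0
  then show ?case by (auto intro: continuous_on_subset)
next
  case (Suc k)
  from Suc.prems(1) obtain f' where "\<forall>x\<in>U. (f has_derivative f' x) (at x)" "\<forall>v. Ck_on k (\<lambda>x. f' x v) U"
    by auto
  then show ?case using Suc.IH Suc.prems(2)
    unfolding Ck_on.simps by (intro exI[of _ f']) blast
qed

lemma Ck_on_SucD: "Ck_on (Suc k) f U \<Longrightarrow> Ck_on k f U"
proof (induction k arbitrary: f)
  case 0
  then show ?case
    by (auto intro!: continuous_at_imp_continuous_on intro: has_derivative_continuous)
next
  case (Suc k)
  from Suc.prems obtain f' where "\<forall>x\<in>U. (f has_derivative f' x) (at x)" "\<forall>v. Ck_on (Suc k) (\<lambda>x. f' x v) U"
    by auto
  then show ?case using Suc.IH unfolding Ck_on.simps(2)[of k f] by blast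
qed

lemma Ck_on_const: "Ck_on k (\<lambda>x. c) U"
proof (induction k arbitrary: c)
  case (Suc k)
  show ?case unfolding Ck_on.simps by (rule exI[of _ "\<lambda>x v. 0"]) (auto simp: Suc)
qed simp

lemma Ck_on_bounded_linear: "bounded_linear L \<Longrightarrow> Ck_on k L U"
proof (cases k)
  case 0
  assume "bounded_linear L"
  then show ?thesis using 0 by (simp add: linear_continuous_on)
next
  case (Suc m)
  assume "bounded_linear L"
  then show ?thesis unfolding Suc Ck_on.simps
    by (intro exI[of _ "\<lambda>x. L"]) (auto intro: bounded_linear_imp_has_derivative Ck_on_const)
qed

lemma Ck_on_add: "Ck_on k f U \<Longrightarrow> Ck_on k g U \<Longrightarrow> Ck_on k (\<lambda>x. f x + g x) U"
proof (induction k arbitrary: f g)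
  case 0
  then show ?case by (auto intro: continuous_on_add)
next
  case (Suc k)
  from Suc.prems obtain f' g' where
    "\<forall>x\<in>U. (f has_derivative f' x) (at x)" "\<forall>v. Ck_on k (\<lambda>x. f' x v) U"
    "\<forall>x\<in>U. (g has_derivative g' x) (at x)" "\<forall>v. Ck_on k (\<lambda>x. g' x v) U"
    by auto
  then show ?case unfolding Ck_on.simps
    by (intro exI[of _ "\<lambda>x v. f' x v + g' x v"]) (auto intro: has_derivative_add Suc.IH)
qed

text \<open>
  All products that occur below (scalar multiplication, inner products, quaternion multiplication,
  Christoffel symbols) are bounded bilinear, so the Leibniz rule is proved once for all of them.
\<close>

lemma Ck_on_bilinear:
  assumes "bounded_bilinear B"
  shows "Ck_on k f U \<Longrightarrow> Ck_on k g U \<Longrightarrow> Ck_on k (\<lambda>x. B (f x) (g x)) U"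
proof (induction k arbitrary: f g)
  case 0
  then show ?case by (auto intro: bounded_bilinear.continuous_on[OF assms])
next
  case (Suc k)
  from Suc.prems obtain f' g' where
    "\<forall>x\<in>U. (f has_derivative f' x) (at x)" "\<forall>v. Ck_on k (\<lambda>x. f' x v) U"
    "\<forall>x\<in>U. (g has_derivative g' x) (at x)" "\<forall>v. Ck_on k (\<lambda>x. g' x v) U"
    by auto
  moreover have "Ck_on k f U" "Ck_on k g U" using Suc.prems Ck_on_SucD by blast+
  ultimately show ?case unfolding Ck_on.simps
    by (intro exI[of _ "\<lambda>x v. B (f x) (g' x v) + B (f' x v) (g x)"])
       (auto intro!: bounded_bilinear.FDERIV[OF assms] Suc.IH Ck_on_add)
qed

lemma Ck_on_linear_compose:
  assumes "bounded_linear L"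
  shows "Ck_on k f U \<Longrightarrow> Ck_on k (\<lambda>x. L (f x)) U"
proof (induction k arbitrary: f)
  case 0
  then show ?case by (auto intro: bounded_linear.continuous_on[OF assms])
next
  case (Suc k)
  from Suc.prems obtain f' where
    "\<forall>x\<in>U. (f has_derivative f' x) (at x)" "\<forall>v. Ck_on k (\<lambda>x. f' x v) U"
    by auto
  then show ?case unfolding Ck_on.simps
    by (intro exI[of _ "\<lambda>x v. L (f' x v)"])
       (auto intro: Suc.IH bounded_linear.has_derivative[OF assms])
qed

lemma Ck_on_compose_linear:
  assumes L: "bounded_linear L" and sub: "L ` V \<subseteq> U"
  shows "Ck_on k f U \<Longrightarrow> Ck_on k (\<lambda>x. f (L x)) V"
proof (induction k arbitrary: f)
  case 0
  then show ?case using continuous_on_compose2[of U f V L] sub linear_continuous_on[OF L]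
    by auto
next
  case (Suc k)
  from Suc.prems obtain f' where f':
    "\<forall>x\<in>U. (f has_derivative f' x) (at x)" "\<forall>v. Ck_on k (\<lambda>x. f' x v) U"
    by auto
  have "((\<lambda>x. f (L x)) has_derivative (\<lambda>v. f' (L x) (L v))) (at x)" if "x \<in> V" for x
    using diff_chain_at[OF bounded_linear_imp_has_derivative[OF L], of f "f' (L x)" x] f'(1) sub that
    by (auto simp: o_def)
  then show ?case using f'(2) Suc.IH unfolding Ck_on.simps
    by (intro exI[of _ "\<lambda>x v. f' (L x) (L v)"]) auto
qed

lemma Ck_on_sum:
  "finite I \<Longrightarrow> (\<And>i. i \<in> I \<Longrightarrow> Ck_on k (f i) U) \<Longrightarrow> Ck_on k (\<lambda>x. \<Sum>i\<in>I. f i x) U"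
  by (induction I rule: finite_induct) (auto intro: Ck_on_const Ck_on_add)

lemma smooth_onE:
  assumes "smooth_on A f" "p \<in> A"
  obtains U F where "open U" "p \<in> U" "\<And>k. Ck_on k F U" "\<And>y. y \<in> A \<Longrightarrow> y \<in> U \<Longrightarrow> F y = f y"
  using assms unfolding smooth_on_def by (metis IntI)

lemma smooth_on_cong:
  assumes "smooth_on A f" "\<And>x. x \<in> A \<Longrightarrow> f x = g x"
  shows "smooth_on A g"
  using assms unfolding smooth_on_def by (metis IntD1)

lemma smooth_on_if_Ck_on_UNIV: "(\<And>k. Ck_on k f UNIV) \<Longrightarrow> smooth_on A f"
  unfolding smooth_on_def by (metis UNIV_I open_UNIV)

lemma smooth_on_const: "smooth_on A (\<lambda>x. c)"
  by (rule smooth_on_if_Ck_on_UNIV) (rule Ck_on_const)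

lemma smooth_on_bounded_linear: "bounded_linear L \<Longrightarrow> smooth_on A L"
  by (rule smooth_on_if_Ck_on_UNIV) (rule Ck_on_bounded_linear)

lemma smooth_on_bilinear:
  assumes B: "bounded_bilinear B" and f: "smooth_on A f" and g: "smooth_on A g"
  shows "smooth_on A (\<lambda>x. B (f x) (g x))"
  unfolding smooth_on_def
proof
  fix p assume "p \<in> A"
  obtain U F where U: "open U" "p \<in> U" "\<And>k. Ck_on k F U" "\<And>y. y \<in> A \<Longrightarrow> y \<in> U \<Longrightarrow> F y = f y"
    using smooth_onE[OF f \<open>p \<in> A\<close>] by blast
  obtain V G where V: "open V" "p \<in> V" "\<And>k. Ck_on k G V" "\<And>y. y \<in> A \<Longrightarrow> y \<in> V \<Longrightarrow> G y = g y"
    using smooth_onE[OF g \<open>p \<in> A\<close>] by blast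
  show "\<exists>U F. open U \<and> p \<in> U \<and> (\<forall>k. Ck_on k F U) \<and> (\<forall>y\<in>A \<inter> U. F y = B (f y) (g y))"
    using U V
    by (intro exI[of _ "U \<inter> V"] exI[of _ "\<lambda>x. B (F x) (G x)"])
       (auto intro!: Ck_on_bilinear[OF B] intro: Ck_on_subset)
qed

lemma smooth_on_linear_compose:
  assumes L: "bounded_linear L" and f: "smooth_on A f"
  shows "smooth_on A (\<lambda>x. L (f x))"
proof -
  have "bounded_bilinear (\<lambda>(a::real) y. a *\<^sub>R L y)"
    using bounded_bilinear.comp[OF bounded_bilinear_scaleR bounded_linear_ident L] .
  from smooth_on_bilinear[OF this smooth_on_const[of A 1] f] show ?thesis by simp
qed

lemma smooth_on_add:
  assumes f: "smooth_on A f" and g: "smooth_on A g"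
  shows "smooth_on A (\<lambda>x. f x + g x)"
  unfolding smooth_on_def
proof
  fix p assume "p \<in> A"
  obtain U F where U: "open U" "p \<in> U" "\<And>k. Ck_on k F U" "\<And>y. y \<in> A \<Longrightarrow> y \<in> U \<Longrightarrow> F y = f y"
    using smooth_onE[OF f \<open>p \<in> A\<close>] by blast
  obtain V G where V: "open V" "p \<in> V" "\<And>k. Ck_on k G V" "\<And>y. y \<in> A \<Longrightarrow> y \<in> V \<Longrightarrow> G y = g y"
    using smooth_onE[OF g \<open>p \<in> A\<close>] by blast
  show "\<exists>U F. open U \<and> p \<in> U \<and> (\<forall>k. Ck_on k F U) \<and> (\<forall>y\<in>A \<inter> U. F y = f y + g y)"
    using U V
    by (intro exI[of _ "U \<inter> V"] exI[of _ "\<lambda>x. F x + G x"])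
       (auto intro!: Ck_on_add intro: Ck_on_subset)
qed

lemma smooth_on_diff:
  fixes f g :: "'a::euclidean_space \<Rightarrow> 'b::real_normed_vector"
  assumes f: "smooth_on A f" and g: "smooth_on A g"
  shows "smooth_on A (\<lambda>x. f x - g x)"
  using smooth_on_add[OF f smooth_on_linear_compose[OF bounded_linear_minus[OF bounded_linear_ident] g]]
  by simp

lemma smooth_on_sum:
  "finite I \<Longrightarrow> (\<And>i. i \<in> I \<Longrightarrow> smooth_on A (f i)) \<Longrightarrow> smooth_on A (\<lambda>x. \<Sum>i\<in>I. f i x)"
  by (induction I rule: finite_induct) (auto intro: smooth_on_const smooth_on_add)

lemma smooth_on_compose_linear:
  assumes L: "bounded_linear L" and sub: "L ` B \<subseteq> A" and f: "smooth_on A f"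
  shows "smooth_on B (\<lambda>x. f (L x))"
  unfolding smooth_on_def
proof
  fix p assume "p \<in> B"
  then obtain U F where U: "open U" "L p \<in> U" "\<And>k. Ck_on k F U" "\<And>y. y \<in> A \<Longrightarrow> y \<in> U \<Longrightarrow> F y = f y"
    using smooth_onE[OF f, of "L p"] sub by blast
  have "open (L -` U)"
    using U(1) linear_continuous_on[OF L, of UNIV] by (simp add: continuous_on_open_vimage)
  then show "\<exists>V G. open V \<and> p \<in> V \<and> (\<forall>k. Ck_on k G V) \<and> (\<forall>y\<in>B \<inter> V. G y = f (L y))"
    using U sub \<open>p \<in> B\<close>
    by (intro exI[of _ "L -` U"] exI[of _ "\<lambda>x. F (L x)"])
       (auto intro!: Ck_on_compose_linear[OF L, where U=U])
qed

section \<open>Differentiation on the sphere\<close>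

lemma radial_projection_has_derivative:
  fixes p :: "'a::real_inner"
  assumes "norm p = 1"
  shows "((\<lambda>x. x /\<^sub>R norm x) has_derivative (\<lambda>v. v - (v \<bullet> p) *\<^sub>R p)) (at p)"
proof -
  have p: "p \<noteq> 0" using assms by auto
  have "((\<lambda>x::'a. norm x) has_derivative (\<lambda>v. v \<bullet> p)) (at p)"
    using has_derivative_norm[OF p] assms by (simp add: sgn_div_norm)
  from has_derivative_scaleR[OF Deriv.has_derivative_inverse[OF _ this] has_derivative_ident]
  show ?thesis using assms p by (simp add: scaleR_minus_left)
qed

text \<open>
  Composing a local extension with the radial projection gives, near the sphere, exactly the radial
  extension of the original map; the chain rule then yields its derivative.
\<close>

lemma has_derivative_radial_extension:
  assumes p: "p \<in> S3" and U: "open U" "p \<in> U" and eq: "\<And>y. y \<in> S3 \<Longrightarrow> y \<in> U \<Longrightarrow> F y = f y"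
    and F: "(F has_derivative F') (at p)"
  shows "((\<lambda>x. f (x /\<^sub>R norm x)) has_derivative (\<lambda>v. F' (v - (v \<bullet> p) *\<^sub>R p))) (at p)"
proof -
  let ?r = "\<lambda>x::R4. x /\<^sub>R norm x"
  have p1: "norm p = 1" using p by simp
  have r: "(?r has_derivative (\<lambda>v. v - (v \<bullet> p) *\<^sub>R p)) (at p)"
    by (rule radial_projection_has_derivative[OF p1])
  have rp: "?r p = p" using p1 by simp
  have d: "((\<lambda>x. F (?r x)) has_derivative (\<lambda>v. F' (v - (v \<bullet> p) *\<^sub>R p))) (at p)"
    using diff_chain_at[OF r, of F F'] F rp by (simp add: o_def)
  have "isCont ?r p" using r by (rule has_derivative_continuous)
  then have "\<forall>\<^sub>F x in at p. ?r x \<in> U"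
    using U rp unfolding isCont_def by (auto dest: topological_tendstoD)
  moreover have "\<forall>\<^sub>F x in at p. x \<noteq> 0"
    using p1 by (intro eventually_neq_at_within)
  ultimately have ev: "\<forall>\<^sub>F x in at p. F (?r x) = f (?r x)"
    by eventually_elim (auto intro!: eq)
  show ?thesis
    using has_derivative_transform_eventually[OF d ev] rp eq[OF p U(2)] by simp
qed

lemma dS3_unique:
  assumes "((\<lambda>x. f (x /\<^sub>R norm x)) has_derivative D) (at p)"
  shows "dS3 f p = D"
  unfolding dS3_def[abs_def] by (rule frechet_derivative_at[OF assms, symmetric])

text \<open>The differential only sees the values on the sphere: any local extension computes it.\<close>

lemma dS3_eq_derivative_of_extension:
  assumes "p \<in> S3" "open U" "p \<in> U" "\<And>y. y \<in> S3 \<Longrightarrow> y \<in> U \<Longrightarrow> F y = f y"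
    and "(F has_derivative F') (at p)"
  shows "dS3 f p v = F' (v - (v \<bullet> p) *\<^sub>R p)"
  using dS3_unique[OF has_derivative_radial_extension[OF assms]] by simp

lemma smooth_on_has_dS3:
  assumes "smooth_on S3 f" "p \<in> S3"
  shows "((\<lambda>x. f (x /\<^sub>R norm x)) has_derivative dS3 f p) (at p)"
proof -
  obtain U F where U: "open U" "p \<in> U" "\<And>k. Ck_on k F U" "\<And>y. y \<in> S3 \<Longrightarrow> y \<in> U \<Longrightarrow> F y = f y"
    using smooth_onE[OF assms] by blast
  obtain F' where "(F has_derivative F') (at p)" using U(2) U(3)[of "Suc 0"] by auto
  from has_derivative_radial_extension[OF assms(2) U(1,2,4) this]
  have "(\<lambda>x. f (x /\<^sub>R norm x)) differentiable (at p)" by (auto simp: differentiable_def)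
  then show ?thesis unfolding dS3_def[abs_def] by (simp only: frechet_derivative_works)
qed

lemma dS3_cong:
  assumes "smooth_on S3 f" "p \<in> S3" "\<And>x. x \<in> S3 \<Longrightarrow> f x = g x"
  shows "dS3 g p v = dS3 f p v"
proof -
  obtain U F where U: "open U" "p \<in> U" "\<And>k. Ck_on k F U" "\<And>y. y \<in> S3 \<Longrightarrow> y \<in> U \<Longrightarrow> F y = f y"
    using smooth_onE[OF assms(1,2)] by blast
  obtain F' where F': "(F has_derivative F') (at p)" using U(2) U(3)[of "Suc 0"] by auto
  show ?thesis
    using dS3_eq_derivative_of_extension[OF assms(2) U(1,2,4) F']
      dS3_eq_derivative_of_extension[OF assms(2) U(1,2) _ F', of g] U(4) assms(3) by simp
qed

lemma linear_dS3: "smooth_on S3 f \<Longrightarrow> p \<in> S3 \<Longrightarrow> linear (dS3 f p)"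
  using smooth_on_has_dS3 has_derivative_linear by blast

lemma dS3_add:
  assumes "smooth_on S3 f" "smooth_on S3 g" "p \<in> S3"
  shows "dS3 (\<lambda>x. f x + g x) p v = dS3 f p v + dS3 g p v"
  using dS3_unique[OF has_derivative_add[OF smooth_on_has_dS3[OF assms(1,3)] smooth_on_has_dS3[OF assms(2,3)]]]
  by simp

lemma dS3_bilinear:
  assumes B: "bounded_bilinear B" and "smooth_on S3 f" "smooth_on S3 g" and p: "p \<in> S3"
  shows "dS3 (\<lambda>x. B (f x) (g x)) p v = B (f p) (dS3 g p v) + B (dS3 f p v) (g p)"
proof -
  have "norm p = 1" using p by simp
  then show ?thesis
  using dS3_unique[OF bounded_bilinear.FDERIV[OF B smooth_on_has_dS3[OF assms(2,4)] smooth_on_has_dS3[OF assms(3,4)]]]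
    by simp
qed

lemma dS3_linear:
  assumes L: "bounded_linear L" and p: "p \<in> S3" and v: "v \<in> tangent_space p"
  shows "dS3 L p v = L v"
proof -
  have "dS3 L p v = L (v - (v \<bullet> p) *\<^sub>R p)"
    by (rule dS3_eq_derivative_of_extension[OF p open_UNIV _ _ bounded_linear_imp_has_derivative[OF L]]) auto
  then show ?thesis using v by (simp add: tangent_space_def)
qed

text \<open>
  If \<open>F\<close> extends \<open>f\<close> near a point of the sphere and \<open>Y\<close> extends \<open>X\<close>, then \<open>X f\<close> is the restriction
  of the directional derivative of \<open>F\<close> along the tangential part of \<open>Y\<close>, which is a polynomial
  expression in \<open>Y\<close>, the position, and the partial derivatives of \<open>F\<close>.
\<close>

lemma smooth_on_dS3:
  assumes f: "smooth_on S3 f" and X: "smooth_on S3 X"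
  shows "smooth_on S3 (\<lambda>q. dS3 f q (X q))"
  unfolding smooth_on_def
proof
  fix p :: R4 assume p: "p \<in> S3"
  obtain U F where U: "open U" "p \<in> U" "\<And>k. Ck_on k F U" "\<And>y. y \<in> S3 \<Longrightarrow> y \<in> U \<Longrightarrow> F y = f y"
    using smooth_onE[OF f p] by blast
  obtain V Y where V: "open V" "p \<in> V" "\<And>k. Ck_on k Y V" "\<And>y. y \<in> S3 \<Longrightarrow> y \<in> V \<Longrightarrow> Y y = X y"
    using smooth_onE[OF X p] by blast
  obtain F' where F': "\<And>x. x \<in> U \<Longrightarrow> (F has_derivative F' x) (at x)"
    using U(3)[of "Suc 0"] by auto
  have F'_Ck: "Ck_on k (\<lambda>x. F' x v) U" for k v
  proof -
    obtain G where G: "\<forall>x\<in>U. (F has_derivative G x) (at x)" "\<forall>v. Ck_on k (\<lambda>x. G x v) U"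
      using U(3)[of "Suc k"] by auto
    have "G x v = F' x v" if "x \<in> U" for x
      using has_derivative_unique[OF G(1)[rule_format, OF that] F'[OF that]] by simp
    then show ?thesis using Ck_on_cong[OF G(2)[rule_format, of v] U(1)] by simp
  qed
  let ?Z = "\<lambda>x. Y x + (- (Y x \<bullet> x)) *\<^sub>R x"
  let ?G = "\<lambda>x. \<Sum>b\<in>Basis. (?Z x \<bullet> b) *\<^sub>R F' x b"
  have ident: "Ck_on k (\<lambda>x. x) W" for k and W :: "R4 set"
    by (rule Ck_on_bounded_linear[OF bounded_linear_ident])
  have YC: "Ck_on k Y (U \<inter> V)" for k using Ck_on_subset[OF V(3)] by blast
  have "Ck_on k (\<lambda>x. Y x \<bullet> x) (U \<inter> V)" for k
    by (rule Ck_on_bilinear[OF bounded_bilinear_inner YC ident])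
  then have "Ck_on k (\<lambda>x. - (Y x \<bullet> x)) (U \<inter> V)" for k
    by (rule Ck_on_linear_compose[OF bounded_linear_minus[OF bounded_linear_ident]])
  then have "Ck_on k (\<lambda>x. (- (Y x \<bullet> x)) *\<^sub>R x) (U \<inter> V)" for k
    by (rule Ck_on_bilinear[OF bounded_bilinear_scaleR _ ident])
  then have ZC: "Ck_on k ?Z (U \<inter> V)" for k
    by (rule Ck_on_add[OF YC])
  have "Ck_on k (\<lambda>x. (?Z x \<bullet> b) *\<^sub>R F' x b) (U \<inter> V)" for k b
    by (rule Ck_on_bilinear[OF bounded_bilinear_scaleR
          Ck_on_linear_compose[OF bounded_linear_inner_left ZC] Ck_on_subset[OF F'_Ck Int_lower1]])
  then have GC: "Ck_on k ?G (U \<inter> V)" for k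
    by (rule Ck_on_sum[OF finite_Basis])
  have Geq: "?G y = dS3 f y (X y)" if y: "y \<in> S3 \<inter> (U \<inter> V)" for y
  proof -
    have "dS3 f y (X y) = F' y (?Z y)"
    proof -
      have "dS3 f y (X y) = F' y (X y - (X y \<bullet> y) *\<^sub>R y)"
        using y by (intro dS3_eq_derivative_of_extension[of y U F f "F' y" "X y"] U F') auto
      then show ?thesis using V(4) y by simp
    qed
    also have "\<dots> = F' y (\<Sum>b\<in>Basis. (?Z y \<bullet> b) *\<^sub>R b)"
      by (simp add: euclidean_representation)
    also have "\<dots> = ?G y"
      using has_derivative_linear[OF F'[of y]] y by (simp add: linear_sum linear_cmul)
    finally show ?thesis by simp
  qed
  show "\<exists>U F. open U \<and> p \<in> U \<and> (\<forall>k. Ck_on k F U) \<and> (\<forall>y\<in>S3 \<inter> U. F y = dS3 f y (X y))"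
  proof (intro exI conjI allI ballI)
    show "open (U \<inter> V)" "p \<in> U \<inter> V" using U V by auto
  qed (use GC Geq in blast)+
qed

section \<open>Unit quaternions and left-invariant metrics\<close>

text \<open>
  The coordinates of \<open>real ^ 4\<close> are the real part followed by the three imaginary parts of a
  quaternion.
\<close>

definition qmult :: "R4 \<Rightarrow> R4 \<Rightarrow> R4" where
  "qmult p q = (\<chi> i.
     if i = 1 then p$1 * q$1 - p$2 * q$2 - p$3 * q$3 - p$4 * q$4
     else if i = 2 then p$1 * q$2 + p$2 * q$1 + p$3 * q$4 - p$4 * q$3
     else if i = 3 then p$1 * q$3 - p$2 * q$4 + p$3 * q$1 + p$4 * q$2
     else p$1 * q$4 + p$2 * q$3 - p$3 * q$2 + p$4 * q$1)"

definition qconj :: "R4 \<Rightarrow> R4" where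
  "qconj p = (\<chi> i. if i = 1 then p$1 else - p$i)"

text \<open>
  \<open>left_field p c\<close> is the product \<open>p * c\<close> with an imaginary quaternion \<open>c\<close>. For fixed \<open>c\<close> this is a
  left-invariant vector field, and for fixed \<open>p\<close> on the sphere it identifies \<open>real ^ 3\<close> with the
  tangent space at \<open>p\<close>; the inverse identification is \<open>coords p\<close>, the imaginary part of
  \<open>conj p * u\<close>.
\<close>

definition left_field :: "R4 \<Rightarrow> real^3 \<Rightarrow> R4" where
  "left_field p c = qmult p (\<chi> i. if i = 1 then 0 else if i = 2 then c$1 else if i = 3 then c$2 else c$3)"

definition coords :: "R4 \<Rightarrow> R4 \<Rightarrow> real^3" where
  "coords p u = (let q = qmult (qconj p) u in \<chi> i. if i = 1 then q$2 else if i = 2 then q$3 else q$4)"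

lemma qmult_nth [simp]:
  "qmult p q $ 1 = p$1 * q$1 - p$2 * q$2 - p$3 * q$3 - p$4 * q$4"
  "qmult p q $ 2 = p$1 * q$2 + p$2 * q$1 + p$3 * q$4 - p$4 * q$3"
  "qmult p q $ 3 = p$1 * q$3 - p$2 * q$4 + p$3 * q$1 + p$4 * q$2"
  "qmult p q $ 4 = p$1 * q$4 + p$2 * q$3 - p$3 * q$2 + p$4 * q$1"
  by (simp_all add: qmult_def)

lemma qconj_nth [simp]:
  "qconj p $ 1 = p$1" "qconj p $ 2 = - p$2" "qconj p $ 3 = - p$3" "qconj p $ 4 = - p$4"
  by (simp_all add: qconj_def)

lemma left_field_nth [simp]:
  "left_field p c $ 1 = - p$2 * c$1 - p$3 * c$2 - p$4 * c$3"
  "left_field p c $ 2 = p$1 * c$1 + p$3 * c$3 - p$4 * c$2"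
  "left_field p c $ 3 = p$1 * c$2 - p$2 * c$3 + p$4 * c$1"
  "left_field p c $ 4 = p$1 * c$3 + p$2 * c$2 - p$3 * c$1"
  by (simp_all add: left_field_def)

lemma coords_nth [simp]:
  "coords p u $ 1 = p$1 * u$2 - p$2 * u$1 - p$3 * u$4 + p$4 * u$3"
  "coords p u $ 2 = p$1 * u$3 + p$2 * u$4 - p$3 * u$1 - p$4 * u$2"
  "coords p u $ 3 = p$1 * u$4 - p$2 * u$3 + p$3 * u$2 - p$4 * u$1"
  by (simp_all add: coords_def Let_def)

lemma cross3_nth [simp]:
  "cross3 x y $ 1 = x$2 * y$3 - x$3 * y$2"
  "cross3 x y $ 2 = x$3 * y$1 - x$1 * y$3"
  "cross3 x y $ 3 = x$1 * y$2 - x$2 * y$1"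
  by (simp_all add: cross_components)

lemmas vec4_simps = vec_eq_iff forall_4 inner_vec_def sum_4

lemma qmult_assoc: "qmult (qmult p q) r = qmult p (qmult q r)"
  by (simp add: vec4_simps algebra_simps)

lemma qmult_inverse: "qmult (qconj p) (qmult p q) = (p \<bullet> p) *\<^sub>R q" "qmult p (qmult (qconj p) q) = (p \<bullet> p) *\<^sub>R q"
  by (simp_all add: vec4_simps algebra_simps)

lemma inner_qconj: "qconj p \<bullet> qconj p = p \<bullet> p"
  by (simp add: vec4_simps)

lemma qmult_qconj_right: "qmult q (qmult (qconj p) p) = (p \<bullet> p) *\<^sub>R q"
  by (simp add: vec4_simps algebra_simps)

lemma inner_qmult: "qmult p q \<bullet> qmult p r = (p \<bullet> p) * (q \<bullet> r)"
  by (simp add: vec4_simps algebra_simps)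

lemma bounded_bilinear_qmult: "bounded_bilinear qmult"
  unfolding bilinear_conv_bounded_bilinear[symmetric] bilinear_def
  by (auto intro!: linearI simp: vec4_simps algebra_simps)

lemma bounded_bilinear_left_field: "bounded_bilinear left_field"
  unfolding bilinear_conv_bounded_bilinear[symmetric] bilinear_def
  by (auto intro!: linearI simp: vec4_simps algebra_simps)

lemma bounded_bilinear_coords: "bounded_bilinear coords"
  unfolding bilinear_conv_bounded_bilinear[symmetric] bilinear_def
  by (auto intro!: linearI simp: vec_eq_iff forall_3 algebra_simps)

lemma bounded_bilinear_cross3: "bounded_bilinear cross3"
  unfolding bilinear_conv_bounded_bilinear[symmetric] by (rule bilinear_cross)

lemma left_field_orthogonal: "left_field p c \<bullet> p = 0"
  by (simp add: vec4_simps algebra_simps)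

lemma left_field_tangent: "left_field p c \<in> tangent_space p"
  by (simp add: tangent_space_def left_field_orthogonal)

lemma coords_left_field: "coords p (left_field p c) = (p \<bullet> p) *\<^sub>R c"
  by (simp add: vec4_simps forall_3 algebra_simps)

lemma left_field_coords: "left_field p (coords p u) = (p \<bullet> p) *\<^sub>R u - (p \<bullet> u) *\<^sub>R p"
  by (simp add: vec4_simps algebra_simps)

lemma inner_S3 [simp]: "p \<in> S3 \<Longrightarrow> p \<bullet> p = 1"
  by (simp add: dot_square_norm)

lemma coords_left_field_S3 [simp]: "p \<in> S3 \<Longrightarrow> coords p (left_field p c) = c"
  by (simp only: coords_left_field inner_S3 scaleR_one)

lemma left_field_coords_S3: "p \<in> S3 \<Longrightarrow> u \<in> tangent_space p \<Longrightarrow> left_field p (coords p u) = u"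
  by (simp only: left_field_coords inner_S3 tangent_space_def mem_Collect_eq inner_commute) simp

lemma coords_self [simp]: "coords p p = 0"
  by (simp add: vec_eq_iff forall_3)

text \<open>Left-invariant fields satisfy the bracket relations of the Lie algebra of imaginary quaternions.\<close>

lemma left_field_commutator:
  "left_field (left_field p x) y - left_field (left_field p y) x = 2 *\<^sub>R left_field p (cross3 x y)"
  by (simp add: vec4_simps algebra_simps)

lemma coords_left_field_left_field:
  "coords (left_field p x) (left_field p y) = - ((p \<bullet> p) *\<^sub>R cross3 x y)"
  by (simp add: vec4_simps forall_3 algebra_simps)

text \<open>This makes left translations by unit quaternions isometries of every left-invariant metric.\<close>

lemma coords_left_translation: "coords (qmult r p) (qmult r u) = (r \<bullet> r) *\<^sub>R coords p u"
  by (simp add: vec4_simps forall_3 algebra_simps)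

definition diag_form :: "real^3 \<Rightarrow> real^3 \<Rightarrow> real^3 \<Rightarrow> real" where
  "diag_form a x y = (\<Sum>i\<in>UNIV. a$i * x$i * y$i)"

definition left_metric :: "real^3 \<Rightarrow> metric" where
  "left_metric a p u v = diag_form a (coords p u) (coords p v)"

lemma diag_form_eq: "diag_form a x y = a$1 * x$1 * y$1 + a$2 * x$2 * y$2 + a$3 * x$3 * y$3"
  by (simp add: diag_form_def sum_3)

lemma bounded_bilinear_diag_form: "bounded_bilinear (diag_form a)"
  unfolding bilinear_conv_bounded_bilinear[symmetric] bilinear_def
  by (auto intro!: linearI simp: diag_form_eq algebra_simps)

definition pos_weights :: "real^3 \<Rightarrow> bool" where
  "pos_weights a \<longleftrightarrow> (\<forall>i. a$i > 0)"

lemma pos_weightsD: "pos_weights a \<Longrightarrow> a$i > 0" by (simp add: pos_weights_def)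

lemma diag_form_pos: "pos_weights a \<Longrightarrow> x \<noteq> 0 \<Longrightarrow> diag_form a x x > 0"
proof -
  assume a: "pos_weights a" and "x \<noteq> 0"
  then obtain j where "x$j \<noteq> 0" by (auto simp: vec_eq_iff)
  then have "0 < a$j * x$j * x$j" using pos_weightsD[OF a, of j]
    by (simp add: mult.assoc zero_less_mult_iff) (metis linorder_neqE_linordered_idom)
  also have "\<dots> \<le> diag_form a x x"
    unfolding diag_form_def using pos_weightsD[OF a]
    by (intro member_le_sum) (auto simp: mult.assoc less_imp_le)
  finally show ?thesis .
qed

lemma vector_fields_smooth: "X \<in> vector_fields \<Longrightarrow> smooth_on S3 X"
  by (simp add: vector_fields_def)

lemma vector_fields_tangent: "X \<in> vector_fields \<Longrightarrow> p \<in> S3 \<Longrightarrow> X p \<in> tangent_space p"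
  by (simp add: vector_fields_def)

lemma smooth_on_ident: "smooth_on A (\<lambda>x. x)"
  by (rule smooth_on_bounded_linear[OF bounded_linear_ident])

lemma smooth_on_coords: "smooth_on S3 X \<Longrightarrow> smooth_on S3 (\<lambda>q. coords q (X q))"
  by (rule smooth_on_bilinear[OF bounded_bilinear_coords smooth_on_ident])

lemma smooth_on_left_field: "smooth_on S3 c \<Longrightarrow> smooth_on S3 (\<lambda>q. left_field q (c q))"
  by (rule smooth_on_bilinear[OF bounded_bilinear_left_field smooth_on_ident])

lemma left_field_in_vector_fields: "smooth_on S3 c \<Longrightarrow> (\<lambda>q. left_field q (c q)) \<in> vector_fields"
  by (simp add: vector_fields_def smooth_on_left_field left_field_tangent)

lemma coords_eq_0_iff: "p \<in> S3 \<Longrightarrow> u \<in> tangent_space p \<Longrightarrow> coords p u = 0 \<longleftrightarrow> u = 0"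
  using left_field_coords_S3[of p u] bounded_bilinear.zero_right[OF bounded_bilinear_left_field, of p]
    bounded_bilinear.zero_right[OF bounded_bilinear_coords, of p] by metis

lemma riemannian_metric_left_metric:
  assumes a: "pos_weights a"
  shows "riemannian_metric (left_metric a)"
  unfolding riemannian_metric_def inner_product_on_def
proof (intro conjI ballI allI impI)
  fix p u v w :: R4 and r s :: real assume p: "p \<in> S3"
  show "left_metric a p u v = left_metric a p v u"
    by (simp add: left_metric_def diag_form_eq)
  show "left_metric a p (r *\<^sub>R u + s *\<^sub>R v) w = r * left_metric a p u w + s * left_metric a p v w"
    unfolding left_metric_def
    by (simp add: bounded_bilinear.add_left[OF bounded_bilinear_diag_form]
      bounded_bilinear.scaleR_left[OF bounded_bilinear_diag_form]
      bounded_bilinear.add_right[OF bounded_bilinear_coords]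
      bounded_bilinear.scaleR_right[OF bounded_bilinear_coords])
  assume "u \<in> tangent_space p" "u \<noteq> 0"
  then show "0 < left_metric a p u u"
    unfolding left_metric_def using diag_form_pos[OF a] coords_eq_0_iff p by blast
next
  fix X Y assume "X \<in> vector_fields" "Y \<in> vector_fields"
  then show "smooth_on S3 (\<lambda>p. left_metric a p (X p) (Y p))"
    unfolding left_metric_def
    by (intro smooth_on_bilinear[OF bounded_bilinear_diag_form] smooth_on_coords vector_fields_smooth)
qed

section \<open>The Levi-Civita connection of a left-invariant metric\<close>

text \<open>
  In the left-invariant frame the Christoffel symbols are constants; the Koszul formula determines
  them from the bracket relations.
\<close>

definition christoffel :: "real^3 \<Rightarrow> real^3 \<Rightarrow> real^3 \<Rightarrow> real^3" where
  "christoffel a x y = (\<chi> i.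
     if i = 1 then ((a$1 - a$2 + a$3) * x$2 * y$3 - (a$1 + a$2 - a$3) * x$3 * y$2) / a$1
     else if i = 2 then ((a$1 + a$2 - a$3) * x$3 * y$1 - (a$2 + a$3 - a$1) * x$1 * y$3) / a$2
     else ((a$2 + a$3 - a$1) * x$1 * y$2 - (a$1 - a$2 + a$3) * x$2 * y$1) / a$3)"

lemma christoffel_nth [simp]:
  "christoffel a x y $ 1 = ((a$1 - a$2 + a$3) * x$2 * y$3 - (a$1 + a$2 - a$3) * x$3 * y$2) / a$1"
  "christoffel a x y $ 2 = ((a$1 + a$2 - a$3) * x$3 * y$1 - (a$2 + a$3 - a$1) * x$1 * y$3) / a$2"
  "christoffel a x y $ 3 = ((a$2 + a$3 - a$1) * x$1 * y$2 - (a$1 - a$2 + a$3) * x$2 * y$1) / a$3"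
  by (simp_all add: christoffel_def)

lemma bounded_bilinear_christoffel: "bounded_bilinear (christoffel a)"
  unfolding bilinear_conv_bounded_bilinear[symmetric] bilinear_def
  by (auto intro!: linearI simp: vec_eq_iff forall_3 add_divide_distrib diff_divide_distrib algebra_simps)

text \<open>
  The next two identities are the algebraic content of the vanishing of the torsion and of the
  compatibility with the metric.
\<close>

lemma christoffel_torsion:
  assumes "pos_weights a"
  shows "christoffel a x y - christoffel a y x = 2 *\<^sub>R cross3 x y"
  using pos_weightsD[OF assms, of 1] pos_weightsD[OF assms, of 2] pos_weightsD[OF assms, of 3]
  by (simp add: vec_eq_iff forall_3 field_simps)

lemma christoffel_metric:
  assumes "pos_weights a"
  shows "diag_form a (christoffel a x y) z + diag_form a y (christoffel a x z) = 0"
  using pos_weightsD[OF assms, of 1] pos_weightsD[OF assms, of 2] pos_weightsD[OF assms, of 3]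
  by (simp add: diag_form_eq) (simp add: algebra_simps)

text \<open>
  In the trivialization of the tangent bundle by left-invariant fields, the connection is the flat
  derivative of the coordinates plus the Christoffel term.
\<close>

definition left_connection :: "real^3 \<Rightarrow> vfield \<Rightarrow> vfield \<Rightarrow> vfield" where
  "left_connection a X Y q =
     left_field q (dS3 (\<lambda>q. coords q (Y q)) q (X q) + christoffel a (coords q (X q)) (coords q (Y q)))"

lemmas coords_linear_simps =
  bounded_bilinear.add_right[OF bounded_bilinear_coords]
  bounded_bilinear.scaleR_right[OF bounded_bilinear_coords]
lemmas left_field_linear_simps =
  bounded_bilinear.add_right[OF bounded_bilinear_left_field]
  bounded_bilinear.diff_right[OF bounded_bilinear_left_field]
  bounded_bilinear.scaleR_right[OF bounded_bilinear_left_field]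
lemmas christoffel_linear_simps =
  bounded_bilinear.add_right[OF bounded_bilinear_christoffel]
  bounded_bilinear.add_left[OF bounded_bilinear_christoffel]
  bounded_bilinear.diff_right[OF bounded_bilinear_christoffel]
  bounded_bilinear.diff_left[OF bounded_bilinear_christoffel]
  bounded_bilinear.scaleR_right[OF bounded_bilinear_christoffel]
  bounded_bilinear.scaleR_left[OF bounded_bilinear_christoffel]
  bounded_bilinear.minus_right[OF bounded_bilinear_christoffel]
  bounded_bilinear.minus_left[OF bounded_bilinear_christoffel]
  bounded_bilinear.zero_right[OF bounded_bilinear_christoffel]
  bounded_bilinear.zero_left[OF bounded_bilinear_christoffel]

lemma left_connection_in_vector_fields:
  assumes "X \<in> vector_fields" "Y \<in> vector_fields"
  shows "left_connection a X Y \<in> vector_fields"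
proof -
  have "smooth_on S3 X" "smooth_on S3 Y" using assms vector_fields_smooth by auto
  then have "(\<lambda>q. left_field q (dS3 (\<lambda>q. coords q (Y q)) q (X q) + christoffel a (coords q (X q)) (coords q (Y q)))) \<in> vector_fields"
    by (intro left_field_in_vector_fields smooth_on_add smooth_on_dS3 smooth_on_coords
        smooth_on_bilinear[OF bounded_bilinear_christoffel])
  then show ?thesis unfolding left_connection_def[abs_def] .
qed

lemma affine_connection_left_connection: "affine_connection (left_connection a)"
  unfolding affine_connection_def
proof (intro conjI ballI allI impI)
  fix X Y assume "X \<in> vector_fields" "Y \<in> vector_fields"
  then show "left_connection a X Y \<in> vector_fields" by (rule left_connection_in_vector_fields)
next
  fix X Y Z p assume v: "X \<in> vector_fields" "Y \<in> vector_fields" "Z \<in> vector_fields" and p: "p \<in> S3"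
  note s = v[THEN vector_fields_smooth, THEN smooth_on_coords]
  show "left_connection a (\<lambda>q. X q + Y q) Z p = left_connection a X Z p + left_connection a Y Z p"
    unfolding left_connection_def
    by (simp add: coords_linear_simps christoffel_linear_simps linear_add[OF linear_dS3[OF s(3) p]]
        left_field_linear_simps)
  show "left_connection a X (\<lambda>q. Y q + Z q) p = left_connection a X Y p + left_connection a X Z p"
    unfolding left_connection_def
    by (simp add: coords_linear_simps christoffel_linear_simps dS3_add[OF s(2,3) p]
        left_field_linear_simps)
next
  fix f :: "R4 \<Rightarrow> real" and X Y p
  assume f: "smooth_on S3 f" and v: "X \<in> vector_fields" "Y \<in> vector_fields" and p: "p \<in> S3"
  note s = v[THEN vector_fields_smooth, THEN smooth_on_coords]
  show "left_connection a (\<lambda>q. f q *\<^sub>R X q) Y p = f p *\<^sub>R left_connection a X Y p"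
    unfolding left_connection_def
    by (simp add: coords_linear_simps christoffel_linear_simps linear_cmul[OF linear_dS3[OF s(2) p]]
        left_field_linear_simps scaleR_add_right)
  show "left_connection a X (\<lambda>q. f q *\<^sub>R Y q) p = dS3 f p (X p) *\<^sub>R Y p + f p *\<^sub>R left_connection a X Y p"
    unfolding left_connection_def
    using left_field_coords_S3[OF p vector_fields_tangent[OF v(2) p]]
    by (simp add: coords_linear_simps christoffel_linear_simps
        dS3_bilinear[OF bounded_bilinear_scaleR f s(2) p] left_field_linear_simps scaleR_add_right)
qed

text \<open>
  A field is its coordinate vector multiplied into the position, so its differential has a part
  from the coordinates and a part from the position; the latter contributes the bracket of the Lie
  algebra.
\<close>

lemma lie_bracket_eq:
  assumes v: "X \<in> vector_fields" "Y \<in> vector_fields" and p: "p \<in> S3"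
  shows "lie_bracket X Y p = left_field p
    (dS3 (\<lambda>q. coords q (Y q)) p (X p) - dS3 (\<lambda>q. coords q (X q)) p (Y p)
      + 2 *\<^sub>R cross3 (coords p (X p)) (coords p (Y p)))"
proof -
  have d: "dS3 W p u = left_field p (dS3 (\<lambda>q. coords q (W q)) p u) + left_field u (coords p (W p))"
    if W: "W \<in> vector_fields" and u: "u \<in> tangent_space p" for W u
  proof -
    note s = smooth_on_coords[OF vector_fields_smooth[OF W]]
    have "dS3 W p u = dS3 (\<lambda>q. left_field q (coords q (W q))) p u"
      by (rule dS3_cong[OF smooth_on_left_field[OF s] p])
         (simp add: left_field_coords_S3 vector_fields_tangent[OF W])
    also have "\<dots> = left_field p (dS3 (\<lambda>q. coords q (W q)) p u) + left_field (dS3 (\<lambda>x. x) p u) (coords p (W p))"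
      by (rule dS3_bilinear[OF bounded_bilinear_left_field smooth_on_ident s p])
    also have "dS3 (\<lambda>x. x) p u = u" by (rule dS3_linear[OF bounded_linear_ident p u])
    finally show ?thesis .
  qed
  note t = vector_fields_tangent[OF v(1) p] vector_fields_tangent[OF v(2) p]
  let ?x = "coords p (X p)" let ?y = "coords p (Y p)"
  have "left_field (X p) ?y - left_field (Y p) ?x = 2 *\<^sub>R left_field p (cross3 ?x ?y)"
    using left_field_commutator[of p ?x ?y] left_field_coords_S3[OF p t(1)] left_field_coords_S3[OF p t(2)]
    by simp
  then show ?thesis
    unfolding lie_bracket_def d[OF v(2) t(1)] d[OF v(1) t(2)] by (simp add: left_field_linear_simps algebra_simps)
qed

lemma is_levi_civita_left_connection:
  assumes a: "pos_weights a"
  shows "is_levi_civita (left_metric a) (left_connection a)"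
  unfolding is_levi_civita_def
proof (intro conjI ballI)
  show "affine_connection (left_connection a)" by (rule affine_connection_left_connection)
next
  fix X Y p assume v: "X \<in> vector_fields" "Y \<in> vector_fields" and p: "p \<in> S3"
  show "left_connection a X Y p - left_connection a Y X p = lie_bracket X Y p"
    unfolding left_connection_def lie_bracket_eq[OF v p] christoffel_torsion[OF a, symmetric]
    by (simp add: left_field_linear_simps algebra_simps)
next
  fix X Y Z p assume v: "X \<in> vector_fields" "Y \<in> vector_fields" "Z \<in> vector_fields" and p: "p \<in> S3"
  note s = v[THEN vector_fields_smooth, THEN smooth_on_coords]
  let ?x = "coords p (X p)" let ?y = "coords p (Y p)" let ?z = "coords p (Z p)"
  have "dS3 (\<lambda>q. left_metric a q (Y q) (Z q)) p (X p) =
    diag_form a ?y (dS3 (\<lambda>q. coords q (Z q)) p (X p)) + diag_form a (dS3 (\<lambda>q. coords q (Y q)) p (X p)) ?z"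
    unfolding left_metric_def
    by (rule dS3_bilinear[OF bounded_bilinear_diag_form s(2,3) p])
  then show "dS3 (\<lambda>q. left_metric a q (Y q) (Z q)) p (X p) =
    left_metric a p (left_connection a X Y p) (Z p) + left_metric a p (Y p) (left_connection a X Z p)"
    using christoffel_metric[OF a, of ?x ?y ?z]
    unfolding left_metric_def left_connection_def
    by (simp add: coords_left_field_S3[OF p] bounded_bilinear.add_right[OF bounded_bilinear_diag_form]
       bounded_bilinear.add_left[OF bounded_bilinear_diag_form])
qed

lemma is_levi_civitaD:
  assumes "is_levi_civita g D" "X \<in> vector_fields" "Y \<in> vector_fields"
  shows "D X Y \<in> vector_fields"
    and "p \<in> S3 \<Longrightarrow> D X Y p - D Y X p = lie_bracket X Y p"
    and "Z \<in> vector_fields \<Longrightarrow> p \<in> S3 \<Longrightarrow>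
      dS3 (\<lambda>q. g q (Y q) (Z q)) p (X p) = g p (D X Y p) (Z p) + g p (Y p) (D X Z p)"
proof -
  show "D X Y \<in> vector_fields"
    using assms by (simp add: is_levi_civita_def affine_connection_def)
  show "D X Y p - D Y X p = lie_bracket X Y p" if "p \<in> S3"
    using assms that unfolding is_levi_civita_def by (metis (no_types))
  show "dS3 (\<lambda>q. g q (Y q) (Z q)) p (X p) = g p (D X Y p) (Z p) + g p (Y p) (D X Z p)"
    if "Z \<in> vector_fields" "p \<in> S3"
    using assms that unfolding is_levi_civita_def by (metis (no_types, lifting))
qed

text \<open>
  The difference of two metric torsion-free connections is symmetric in its first two arguments and
  antisymmetric in the last two, hence vanishes.
\<close>

lemma levi_civita_connection_unique:
  assumes g: "riemannian_metric g" and D: "is_levi_civita g D" and E: "is_levi_civita g E"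
    and v: "X \<in> vector_fields" "Y \<in> vector_fields" and p: "p \<in> S3"
    and ext: "\<And>u. u \<in> tangent_space p \<Longrightarrow> \<exists>Z\<in>vector_fields. Z p = u"
  shows "D X Y p = E X Y p"
proof -
  let ?T = "tangent_space p"
  have diff_tangent: "u - w \<in> ?T" if "u \<in> ?T" "w \<in> ?T" for u w
    using that by (simp add: tangent_space_def inner_diff_left)
  have ip: "inner_product_on ?T (g p)" using g p by (simp add: riemannian_metric_def)
  have sym: "g p u w = g p w u" if "u \<in> ?T" "w \<in> ?T" for u w
    using ip that by (simp add: inner_product_on_def)
  have diff: "g p (u - w) z = g p u z - g p w z" if "u \<in> ?T" "w \<in> ?T" "z \<in> ?T" for u w z
  proof -
    have "g p (1 *\<^sub>R u + (-1) *\<^sub>R w) z = 1 * g p u z + (-1) * g p w z"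
      using ip that unfolding inner_product_on_def by blast
    then show ?thesis by simp
  qed
  note DV = is_levi_civitaD(1)[OF D] and EV = is_levi_civitaD(1)[OF E]
  note tan = vector_fields_tangent[OF _ p]
  define S where "S X Y Z = g p (D X Y p - E X Y p) (Z p)" for X Y Z
  have S12: "S X Y Z = S Y X Z" if "X \<in> vector_fields" "Y \<in> vector_fields" for X Y Z
  proof -
    have "D X Y p - D Y X p = E X Y p - E Y X p"
      using is_levi_civitaD(2)[OF D that p] is_levi_civitaD(2)[OF E that p] by simp
    then have "D X Y p - E X Y p = D Y X p - E Y X p" by (simp add: algebra_simps)
    then show ?thesis unfolding S_def by simp
  qed
  have S23: "S X Y Z = - S X Z Y" if V: "X \<in> vector_fields" "Y \<in> vector_fields" "Z \<in> vector_fields" for X Y Z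
  proof -
    have "g p (D X Y p) (Z p) + g p (Y p) (D X Z p) = g p (E X Y p) (Z p) + g p (Y p) (E X Z p)"
      using is_levi_civitaD(3)[OF D V(1,2,3) p] is_levi_civitaD(3)[OF E V(1,2,3) p] by simp
    moreover have "g p (Y p) (D X Z p - E X Z p) = g p (D X Z p - E X Z p) (Y p)"
      by (rule sym) (intro diff_tangent tan DV EV V)+
    moreover have "g p (Y p) (D X Z p) = g p (D X Z p) (Y p)" "g p (Y p) (E X Z p) = g p (E X Z p) (Y p)"
      by (rule sym; intro tan DV EV V)+
    moreover have "S X Y Z = g p (D X Y p) (Z p) - g p (E X Y p) (Z p)"
      "S X Z Y = g p (D X Z p) (Y p) - g p (E X Z p) (Y p)"
      unfolding S_def by (rule diff; intro tan DV EV V)+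
    ultimately show ?thesis by simp
  qed
  have S0: "S X Y Z = 0" if Z: "Z \<in> vector_fields" for Z
  proof -
    have "S X Y Z = S Y X Z" by (rule S12[OF v])
    also have "\<dots> = - S Y Z X" by (rule S23[OF v(2,1) Z])
    also have "\<dots> = - S Z Y X" by (simp only: S12[OF v(2) Z])
    also have "\<dots> = S Z X Y" by (simp only: S23[OF Z v(2,1)] minus_minus)
    also have "\<dots> = S X Z Y" by (rule S12[OF Z v(1)])
    also have "\<dots> = - S X Y Z" by (rule S23[OF v(1) Z v(2)])
    finally show ?thesis by simp
  qed
  have dT: "D X Y p - E X Y p \<in> ?T" by (intro diff_tangent tan DV EV v)
  from ext[OF this] obtain Z where Z: "Z \<in> vector_fields" "Z p = D X Y p - E X Y p" ..
  have "g p (D X Y p - E X Y p) (D X Y p - E X Y p) = 0"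
    using S0[OF Z(1)] unfolding S_def Z(2) .
  moreover have "\<forall>u\<in>?T. u \<noteq> 0 \<longrightarrow> g p u u > 0" using ip unfolding inner_product_on_def by (elim conjE)
  ultimately have "D X Y p - E X Y p = 0" using dT by (metis less_irrefl)
  then show ?thesis by simp
qed

lemma smooth_on_extend_tangent: "smooth_on A (extend_tangent u)"
  unfolding extend_tangent_def
  by (intro smooth_on_diff smooth_on_const smooth_on_bilinear[OF bounded_bilinear_scaleR]
      smooth_on_bilinear[OF bounded_bilinear_inner] smooth_on_ident)

lemma extend_tangent_in_vector_fields: "extend_tangent u \<in> vector_fields"
  unfolding vector_fields_def
  using smooth_on_extend_tangent
  by (auto simp: extend_tangent_def tangent_space_def inner_diff_left dot_square_norm)

lemma extend_tangent_at: "u \<in> tangent_space p \<Longrightarrow> extend_tangent u p = u"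
  by (simp add: extend_tangent_def tangent_space_def)

lemma is_levi_civita_levi_civita:
  "pos_weights a \<Longrightarrow> is_levi_civita (left_metric a) (levi_civita (left_metric a))"
  unfolding levi_civita_def by (rule someI[of _ "left_connection a"]) (rule is_levi_civita_left_connection)

lemma levi_civita_left_metric:
  assumes a: "pos_weights a" and v: "X \<in> vector_fields" "Y \<in> vector_fields" and p: "p \<in> S3"
  shows "levi_civita (left_metric a) X Y p = left_connection a X Y p"
  using extend_tangent_in_vector_fields extend_tangent_at
  by (intro levi_civita_connection_unique[OF riemannian_metric_left_metric[OF a]
      is_levi_civita_levi_civita[OF a] is_levi_civita_left_connection[OF a] v p]) blast

text \<open>
  The Levi-Civita connection is only determined on the sphere. Iterated covariant derivatives may
  still be computed with the explicit connection, because it ignores the values elsewhere.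
\<close>

lemma left_connection_cong:
  assumes "Y \<in> vector_fields" "p \<in> S3" "\<And>q. q \<in> S3 \<Longrightarrow> Y q = Y' q"
  shows "left_connection a X Y' p = left_connection a X Y p"
  unfolding left_connection_def
  using dS3_cong[OF smooth_on_coords[OF vector_fields_smooth[OF assms(1)]] assms(2), of "\<lambda>q. coords q (Y' q)"]
    assms(2,3) by simp

section \<open>The curvature of a left-invariant metric\<close>

lemma lie_bracket_in_vector_fields:
  assumes v: "X \<in> vector_fields" "Y \<in> vector_fields"
  shows "lie_bracket X Y \<in> vector_fields"
proof -
  note s = v[THEN vector_fields_smooth]
  let ?c = "\<lambda>p. dS3 (\<lambda>q. coords q (Y q)) p (X p) - dS3 (\<lambda>q. coords q (X q)) p (Y p)
      + 2 *\<^sub>R cross3 (coords p (X p)) (coords p (Y p))"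
  have "smooth_on S3 ?c"
    by (intro smooth_on_add smooth_on_diff smooth_on_dS3 smooth_on_coords s
        smooth_on_bilinear[OF bounded_bilinear_scaleR] smooth_on_const
        smooth_on_bilinear[OF bounded_bilinear_cross3])
  then have "smooth_on S3 (\<lambda>p. left_field p (?c p))" by (rule smooth_on_left_field)
  then have "smooth_on S3 (lie_bracket X Y)"
    by (rule smooth_on_cong) (simp add: lie_bracket_eq[OF v])
  then show ?thesis
    by (simp add: vector_fields_def lie_bracket_eq[OF v] left_field_tangent del: mem_sphere mem_sphere_0)
qed

lemma extend_tangent_has_derivative:
  "(extend_tangent v has_derivative (\<lambda>h. - ((v \<bullet> h) *\<^sub>R p + (v \<bullet> p) *\<^sub>R h))) (at p)"
  unfolding extend_tangent_def[abs_def]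
  by (auto intro!: derivative_eq_intros)

lemma dS3_eq_derivative:
  assumes "p \<in> S3" "u \<in> tangent_space p" "(F has_derivative F') (at p)"
  shows "dS3 F p u = F' u"
  using dS3_eq_derivative_of_extension[OF assms(1) open_UNIV UNIV_I _ assms(3), of F u] assms(2)
  by (simp add: tangent_space_def)

text \<open>
  At \<open>p\<close>, the derivative of one projected constant field along the other is \<open>- (u \<bullet> v) *\<^sub>R p\<close>, which is
  symmetric in the two fields.
\<close>

lemma lie_bracket_extend_tangent:
  assumes p: "p \<in> S3" and u: "u \<in> tangent_space p" and v: "v \<in> tangent_space p"
  shows "lie_bracket (extend_tangent u) (extend_tangent v) p = 0"
  unfolding lie_bracket_def extend_tangent_at[OF u] extend_tangent_at[OF v]
    dS3_eq_derivative[OF p u extend_tangent_has_derivative] dS3_eq_derivative[OF p v extend_tangent_has_derivative]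
  using u v by (simp add: tangent_space_def inner_commute)

text \<open>
  The position vector has no imaginary coordinates, so the coordinates of the projection of a
  constant vector are linear in the position. This is what makes the second covariant derivatives
  below computable without second derivatives of general functions.
\<close>

lemma coords_extend_tangent [simp]: "coords q (extend_tangent w q) = coords q w"
  by (simp add: extend_tangent_def bounded_bilinear.diff_right[OF bounded_bilinear_coords]
      bounded_bilinear.scaleR_right[OF bounded_bilinear_coords])

lemma left_connection_extend_tangent:
  assumes q: "q \<in> S3"
  shows "left_connection a (extend_tangent v) (extend_tangent w) q =
    left_field q (coords (extend_tangent v q) w + christoffel a (coords q v) (coords q w))"
  unfolding left_connection_def
  using dS3_linear[OF bounded_bilinear.bounded_linear_left[OF bounded_bilinear_coords, of w] q
      vector_fields_tangent[OF extend_tangent_in_vector_fields q]]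
  by simp

lemma left_connection_left_connection:
  assumes p: "p \<in> S3" and u: "u \<in> tangent_space p" and v: "v \<in> tangent_space p"
  shows "left_connection a (extend_tangent u) (left_connection a (extend_tangent v) (extend_tangent w)) p =
    left_field p (- ((v \<bullet> u) *\<^sub>R coords p w) + christoffel a (coords u v) (coords p w)
      + christoffel a (coords p v) (coords u w)
      + christoffel a (coords p u) (coords v w + christoffel a (coords p v) (coords p w)))"
proof -
  let ?H = "\<lambda>q. coords (extend_tangent v q) w + christoffel a (coords q v) (coords q w)"
  let ?W = "left_connection a (extend_tangent v) (extend_tangent w)"
  have lin: "smooth_on S3 (\<lambda>q. coords q x)" for x
    by (rule smooth_on_bounded_linear[OF bounded_bilinear.bounded_linear_left[OF bounded_bilinear_coords]])
  have H: "smooth_on S3 ?H"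
    by (intro smooth_on_add smooth_on_bilinear[OF bounded_bilinear_christoffel] lin
        smooth_on_bilinear[OF bounded_bilinear_coords] smooth_on_extend_tangent smooth_on_const)
  have W: "coords q (?W q) = ?H q" if "q \<in> S3" for q
    by (simp only: left_connection_extend_tangent[OF that] coords_left_field_S3[OF that])
  have d: "(?H has_derivative (\<lambda>h. coords (- ((v \<bullet> h) *\<^sub>R p + (v \<bullet> p) *\<^sub>R h)) w +
      (christoffel a (coords p v) (coords h w) + christoffel a (coords h v) (coords p w)))) (at p)"
    by (intro has_derivative_add bounded_bilinear.FDERIV[OF bounded_bilinear_christoffel]
       bounded_linear.has_derivative[OF bounded_bilinear.bounded_linear_left[OF bounded_bilinear_coords]]
       extend_tangent_has_derivative has_derivative_ident)
  have "dS3 (\<lambda>q. coords q (?W q)) p u = dS3 ?H p u"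
    by (rule dS3_cong[OF H p]) (simp only: W)
  also have "\<dots> = coords (- ((v \<bullet> u) *\<^sub>R p)) w + (christoffel a (coords p v) (coords u w) + christoffel a (coords u v) (coords p w))"
    using dS3_eq_derivative[OF p u d] v by (simp add: tangent_space_def)
  finally have e: "dS3 (\<lambda>q. coords q (?W q)) p u = coords (- ((v \<bullet> u) *\<^sub>R p)) w
    + (christoffel a (coords p v) (coords u w) + christoffel a (coords u v) (coords p w))" .
  show ?thesis
    unfolding left_connection_def[of a "extend_tangent u" ?W] extend_tangent_at[OF u] W[OF p] extend_tangent_at[OF v] e
      coords_extend_tangent
    by (simp add: bounded_bilinear.minus_left[OF bounded_bilinear_coords]
        bounded_bilinear.scaleR_left[OF bounded_bilinear_coords] algebra_simps)
qed

text \<open>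
  The terms symmetric in \<open>u\<close> and \<open>v\<close> cancel, the bracket of the two extensions vanishes at \<open>p\<close>, and
  what remains is the curvature of a connection with constant coefficients on a Lie algebra.
\<close>

lemma curvature_op_left_metric:
  fixes w :: R4
  assumes a: "pos_weights a" and p: "p \<in> S3" and u: "u \<in> tangent_space p" and v: "v \<in> tangent_space p"
  defines "x \<equiv> coords p u" and "y \<equiv> coords p v" and "z \<equiv> coords p w"
  shows "curvature_op (left_metric a) (extend_tangent u) (extend_tangent v) (extend_tangent w) p =
    left_field p (christoffel a x (christoffel a y z) - christoffel a y (christoffel a x z)
      - 2 *\<^sub>R christoffel a (cross3 x y) z)"
proof -
  let ?D = "levi_civita (left_metric a)"
  note E = extend_tangent_in_vector_fields
  have DD: "?D (extend_tangent u) (?D (extend_tangent v) (extend_tangent w)) p =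
    left_connection a (extend_tangent u) (left_connection a (extend_tangent v) (extend_tangent w)) p" for u v
  proof -
    have V: "?D (extend_tangent v) (extend_tangent w) \<in> vector_fields"
      by (rule is_levi_civitaD(1)[OF is_levi_civita_levi_civita[OF a] E E])
    have "?D (extend_tangent u) (?D (extend_tangent v) (extend_tangent w)) p =
      left_connection a (extend_tangent u) (?D (extend_tangent v) (extend_tangent w)) p"
      by (rule levi_civita_left_metric[OF a E V p])
    also have "\<dots> = left_connection a (extend_tangent u) (left_connection a (extend_tangent v) (extend_tangent w)) p"
      by (rule left_connection_cong[OF left_connection_in_vector_fields[OF E E] p])
         (simp only: levi_civita_left_metric[OF a E E])
    finally show ?thesis .
  qed
  have "?D (lie_bracket (extend_tangent u) (extend_tangent v)) (extend_tangent w) p =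
    left_connection a (lie_bracket (extend_tangent u) (extend_tangent v)) (extend_tangent w) p"
    by (rule levi_civita_left_metric[OF a lie_bracket_in_vector_fields[OF E E] E p])
  also have "\<dots> = 0"
    unfolding left_connection_def lie_bracket_extend_tangent[OF p u v]
    using linear_0[OF linear_dS3[OF smooth_on_coords[OF smooth_on_extend_tangent] p]]
    by (simp add: bounded_bilinear.zero_right[OF bounded_bilinear_coords] christoffel_linear_simps
        bounded_bilinear.zero_right[OF bounded_bilinear_left_field])
  finally have D0: "?D (lie_bracket (extend_tangent u) (extend_tangent v)) (extend_tangent w) p = 0" .
  have uv: "coords u v = - cross3 x y" "coords v u = cross3 x y"
    using coords_left_field_left_field[of p x y] coords_left_field_left_field[of p y x] p
      left_field_coords_S3[OF p u] left_field_coords_S3[OF p v] cross_skew[of y x]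
    by (auto simp: x_def y_def)
  show ?thesis
    unfolding curvature_op_def Let_def DD D0 left_connection_left_connection[OF p u v]
      left_connection_left_connection[OF p v u] x_def[symmetric] y_def[symmetric] z_def[symmetric] uv
    by (simp add: left_field_linear_simps[symmetric] christoffel_linear_simps inner_commute[of u v] scaleR_2)
qed

text \<open>
  The sectional curvature of the plane spanned by the left-invariant fields with indices \<open>i\<close> and
  \<open>j\<close> is \<open>curv_coeff a $ k / (a$i * a$j)\<close>, where \<open>k\<close> is the third index.
\<close>

definition curv_coeff :: "real^3 \<Rightarrow> real^3" where
  "curv_coeff a = (\<chi> i.
     if i = 1 then 2 * (a$2 + a$3 - a$1) - (a$1 - a$2 + a$3) * (a$1 + a$2 - a$3) / a$1
     else if i = 2 then 2 * (a$1 - a$2 + a$3) - (a$1 + a$2 - a$3) * (a$2 + a$3 - a$1) / a$2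
     else 2 * (a$1 + a$2 - a$3) - (a$2 + a$3 - a$1) * (a$1 - a$2 + a$3) / a$3)"

lemma curv_coeff_nth [simp]:
  "curv_coeff a $ 1 = 2 * (a$2 + a$3 - a$1) - (a$1 - a$2 + a$3) * (a$1 + a$2 - a$3) / a$1"
  "curv_coeff a $ 2 = 2 * (a$1 - a$2 + a$3) - (a$1 + a$2 - a$3) * (a$2 + a$3 - a$1) / a$2"
  "curv_coeff a $ 3 = 2 * (a$1 + a$2 - a$3) - (a$2 + a$3 - a$1) * (a$1 - a$2 + a$3) / a$3"
  by (simp_all add: curv_coeff_def)

text \<open>
  In dimension three the curvature is a symmetric form on bivectors, that is, on cross products; for
  a diagonal left-invariant metric this form is again diagonal.
\<close>

lemma christoffel_curvature:
  assumes "pos_weights a"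
  shows "diag_form a (christoffel a x (christoffel a y z) - christoffel a y (christoffel a x z)
      - 2 *\<^sub>R christoffel a (cross3 x y) z) w = - diag_form (curv_coeff a) (cross3 x y) (cross3 z w)"
proof -
  \<comment> \<open>With the reciprocals as independent unknowns the claim is a polynomial identity modulo \<open>a$i * b i = 1\<close>.\<close>
  define b where "b i = 1 / a$i" for i
  have ab: "a$i * b i = 1" for i using pos_weightsD[OF assms, of i] by (simp add: b_def)
  have div: "r / a$i = r * b i" for r i by (simp add: b_def)
  note ab' = ab[of 1] ab[of 2] ab[of 3]
  show ?thesis
    unfolding diag_form_eq vector_minus_component vector_scaleR_component christoffel_nth cross3_nth curv_coeff_nth div real_scaleR_def
    using ab' by algebra
qed

lemma Rm_left_metric:
  assumes a: "pos_weights a" and p: "p \<in> S3" and u: "u \<in> tangent_space p" and v: "v \<in> tangent_space p"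
  shows "Rm (left_metric a) p u v w z =
    - diag_form (curv_coeff a) (cross3 (coords p u) (coords p v)) (cross3 (coords p w) (coords p z))"
  unfolding Rm_def curvature_op_left_metric[OF a p u v] left_metric_def coords_left_field_S3[OF p]
    christoffel_curvature[OF a] ..

section \<open>Contractions of the curvature\<close>

text \<open>
  The Gram matrix of an orthonormal basis with respect to the inverse form: a matrix with orthonormal
  rows also has orthonormal columns.
\<close>

lemma dual_gram_of_orthonormal:
  fixes c :: "3 \<Rightarrow> real^3"
  assumes a: "pos_weights a" and c: "\<And>i j. diag_form a (c i) (c j) = (if i = j then 1 else 0)"
  shows "(\<Sum>i\<in>UNIV. c i $ k * c i $ l) = (if k = l then 1 / a$k else 0)"
proof -
  define M :: "real^3^3" where "M = (\<chi> i k. sqrt (a$k) * c i $ k)"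
  note pos = pos_weightsD[OF a]
  have sq: "sqrt (a$k) * sqrt (a$k) = a$k" for k using pos[of k] by simp
  have "M ** transpose M = mat 1"
  proof -
    have "(\<Sum>k\<in>UNIV. sqrt (a$k) * c i $ k * (sqrt (a$k) * c j $ k)) = diag_form a (c i) (c j)" for i j
      unfolding diag_form_def using sq by (intro sum.cong refl) (metis mult.assoc mult.commute)
    then show ?thesis
      by (simp add: matrix_matrix_mult_def transpose_def M_def mat_def vec_eq_iff c)
  qed
  then have "transpose M ** M = mat 1" by (simp add: matrix_left_right_inverse)
  then have "(transpose M ** M) $ k $ l = mat 1 $ k $ l" by simp
  then have "sqrt (a$k) * sqrt (a$l) * (\<Sum>i\<in>UNIV. c i $ k * c i $ l) = (if k = l then 1 else 0)"
    by (simp add: matrix_matrix_mult_def transpose_def M_def mat_def sum_distrib_left ac_simps)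
  moreover have "sqrt (a$k) * sqrt (a$l) \<noteq> 0" using pos[of k] pos[of l] by simp
  ultimately show ?thesis using sq[of k] pos[of k]
    by (cases "k = l") (simp_all add: eq_divide_eq mult.commute)
qed

text \<open>A trace may be computed in the coordinate basis, whichever orthonormal basis defines it.\<close>

lemma trace_orthonormal:
  fixes c :: "3 \<Rightarrow> real^3" and B :: "real^3 \<Rightarrow> real^3 \<Rightarrow> real"
  assumes a: "pos_weights a" and c: "\<And>i j. diag_form a (c i) (c j) = (if i = j then 1 else 0)"
    and B: "bounded_bilinear B"
  shows "(\<Sum>i\<in>UNIV. B (c i) (c i)) = (\<Sum>k\<in>UNIV. B (axis k 1) (axis k 1) / a$k)"
proof -
  have e: "c i = (\<Sum>k\<in>UNIV. c i $ k *\<^sub>R axis k 1)" for i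
    using basis_expansion[of "c i"] by (simp add: scalar_mult_eq_scaleR)
  have l: "B (c i) x = (\<Sum>k\<in>UNIV. c i $ k * B (axis k 1) x)" for i x
    by (subst e) (simp add: bounded_bilinear.sum_left[OF B] bounded_bilinear.scaleR_left[OF B])
  have r: "B x (c i) = (\<Sum>k\<in>UNIV. c i $ k * B x (axis k 1))" for i x
    by (subst e) (simp add: bounded_bilinear.sum_right[OF B] bounded_bilinear.scaleR_right[OF B])
  have "B (c i) (c i) = (\<Sum>k\<in>UNIV. \<Sum>l\<in>UNIV. (c i $ k * c i $ l) * B (axis k 1) (axis l 1))" for i
    by (subst l) (simp only: r sum_distrib_left mult.assoc)
  then have "(\<Sum>i\<in>UNIV. B (c i) (c i)) =
      (\<Sum>i\<in>UNIV. \<Sum>k\<in>UNIV. \<Sum>l\<in>UNIV. (c i $ k * c i $ l) * B (axis k 1) (axis l 1))"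
    by simp
  also have "\<dots> = (\<Sum>k\<in>UNIV. \<Sum>l\<in>UNIV. \<Sum>i\<in>UNIV. (c i $ k * c i $ l) * B (axis k 1) (axis l 1))"
    by (subst sum.swap) (intro sum.cong refl sum.swap)
  also have "\<dots> = (\<Sum>k\<in>UNIV. \<Sum>l\<in>UNIV. (if k = l then 1 / a$k else 0) * B (axis k 1) (axis l 1))"
    by (simp only: sum_distrib_right[symmetric] dual_gram_of_orthonormal[OF a c])
  also have "\<dots> = (\<Sum>k\<in>UNIV. B (axis k 1) (axis k 1) / a$k)"
    by (simp add: if_distrib[of "\<lambda>x. x * _"] cong: if_cong)
  finally show ?thesis .
qed

lemma orthonormal_frame_coords:
  assumes "orthonormal_frame (left_metric a) p e"
  shows "diag_form a (coords p (e i)) (coords p (e j)) = (if i = j then 1 else 0)"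
  using assms by (simp add: orthonormal_frame_def left_metric_def)

lemma axis_nth3 [simp]:
  "axis (1::3) x $ 1 = x" "axis (1::3) x $ 2 = 0" "axis (1::3) x $ 3 = 0"
  "axis (2::3) x $ 1 = 0" "axis (2::3) x $ 2 = x" "axis (2::3) x $ 3 = 0"
  "axis (3::3) x $ 1 = 0" "axis (3::3) x $ 2 = 0" "axis (3::3) x $ 3 = x"
  by (simp_all add: axis_def)

lemma orthonormal_frame_frame_at:
  assumes a: "pos_weights a" and p: "p \<in> S3"
  shows "orthonormal_frame (left_metric a) p (frame_at (left_metric a) p)"
proof -
  have "diag_form a (axis i (1 / sqrt (a$i))) (axis j (1 / sqrt (a$j))) = (if i = j then 1 else 0)" for i j
    using pos_weightsD[OF a, of i]
    by (auto simp: diag_form_def axis_def if_distrib[of "\<lambda>x. _ * x"] if_distrib[of "\<lambda>x. x * _"] cong: if_cong)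
  then have "orthonormal_frame (left_metric a) p (\<lambda>i. left_field p (axis i (1 / sqrt (a$i))))"
    by (simp add: orthonormal_frame_def left_metric_def left_field_tangent coords_left_field_S3[OF p])
  then show ?thesis unfolding frame_at_def by (rule someI[where P = "orthonormal_frame (left_metric a) p"])
qed

text \<open>The Ricci tensor is diagonal in the left-invariant frame, with these entries.\<close>

definition ricci_coeff :: "real^3 \<Rightarrow> real^3" where
  "ricci_coeff a = (\<chi> i.
     if i = 1 then 2 * ((a$1)\<^sup>2 - (a$2 - a$3)\<^sup>2) / (a$2 * a$3)
     else if i = 2 then 2 * ((a$2)\<^sup>2 - (a$3 - a$1)\<^sup>2) / (a$3 * a$1)
     else 2 * ((a$3)\<^sup>2 - (a$1 - a$2)\<^sup>2) / (a$1 * a$2))"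

lemma ricci_coeff_nth [simp]:
  "ricci_coeff a $ 1 = 2 * ((a$1)\<^sup>2 - (a$2 - a$3)\<^sup>2) / (a$2 * a$3)"
  "ricci_coeff a $ 2 = 2 * ((a$2)\<^sup>2 - (a$3 - a$1)\<^sup>2) / (a$3 * a$1)"
  "ricci_coeff a $ 3 = 2 * ((a$3)\<^sup>2 - (a$1 - a$2)\<^sup>2) / (a$1 * a$2)"
  by (simp_all add: ricci_coeff_def)

lemma ricci_coeff_eq:
  assumes "pos_weights a"
  shows "ricci_coeff a $ 1 = curv_coeff a $ 3 / a$2 + curv_coeff a $ 2 / a$3"
    "ricci_coeff a $ 2 = curv_coeff a $ 1 / a$3 + curv_coeff a $ 3 / a$1"
    "ricci_coeff a $ 3 = curv_coeff a $ 2 / a$1 + curv_coeff a $ 1 / a$2"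
  using pos_weightsD[OF assms, of 1] pos_weightsD[OF assms, of 2] pos_weightsD[OF assms, of 3]
  by (simp_all add: field_simps power2_eq_square)

lemma Ric_left_metric:
  assumes a: "pos_weights a" and p: "p \<in> S3" and v: "v \<in> tangent_space p"
  shows "Ric (left_metric a) p v w = diag_form (ricci_coeff a) (coords p v) (coords p w)"
proof -
  define e where "e = frame_at (left_metric a) p"
  have e: "orthonormal_frame (left_metric a) p e"
    unfolding e_def by (rule orthonormal_frame_frame_at[OF a p])
  have et: "e i \<in> tangent_space p" for i using e by (simp add: orthonormal_frame_def)
  let ?y = "coords p v" and ?z = "coords p w"
  let ?B = "\<lambda>x x'. diag_form (curv_coeff a) (cross3 x ?y) (cross3 ?z x')"
  have B: "bounded_bilinear ?B"
    using bounded_bilinear.comp[OF bounded_bilinear_diag_form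
      bounded_bilinear.bounded_linear_left[OF bounded_bilinear_cross3]
      bounded_bilinear.bounded_linear_right[OF bounded_bilinear_cross3]] .
  have "Ric (left_metric a) p v w = - (\<Sum>i\<in>UNIV. ?B (coords p (e i)) (coords p (e i)))"
    unfolding Ric_def Let_def e_def[symmetric] Rm_left_metric[OF a p et v] sum_negf ..
  also have "\<dots> = - (\<Sum>k\<in>UNIV. ?B (axis k 1) (axis k 1) / a$k)"
    by (simp only: trace_orthonormal[OF a orthonormal_frame_coords[OF e] B])
  also have "\<dots> = diag_form (ricci_coeff a) ?y ?z"
    unfolding sum_3 diag_form_eq[of "ricci_coeff a"] ricci_coeff_eq[OF a]
    by (simp add: diag_form_eq add_divide_distrib diff_divide_distrib algebra_simps del: curv_coeff_nth coords_nth)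
  finally show ?thesis .
qed

lemma scal_left_metric:
  assumes a: "pos_weights a" and p: "p \<in> S3"
  shows "scal (left_metric a) p = (\<Sum>k\<in>UNIV. ricci_coeff a $ k / a$k)"
proof -
  define e where "e = frame_at (left_metric a) p"
  have e: "orthonormal_frame (left_metric a) p e"
    unfolding e_def by (rule orthonormal_frame_frame_at[OF a p])
  have et: "e i \<in> tangent_space p" for i using e by (simp add: orthonormal_frame_def)
  have "scal (left_metric a) p = (\<Sum>i\<in>UNIV. diag_form (ricci_coeff a) (coords p (e i)) (coords p (e i)))"
    unfolding scal_def Let_def e_def[symmetric] Ric_left_metric[OF a p et] ..
  also have "\<dots> = (\<Sum>k\<in>UNIV. diag_form (ricci_coeff a) (axis k 1) (axis k 1) / a$k)"
    by (rule trace_orthonormal[OF a orthonormal_frame_coords[OF e] bounded_bilinear_diag_form])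
  also have "\<dots> = (\<Sum>k\<in>UNIV. ricci_coeff a $ k / a$k)"
    by (simp add: sum_3 diag_form_eq del: ricci_coeff_nth)
  finally show ?thesis .
qed

text \<open>
  The bivectors \<open>c i\<close> wedge \<open>c j\<close> of an orthonormal basis form, up to sign, an orthonormal basis of
  bivectors counted twice, hence the factor two. The square of the norm of the curvature uses this
  once for each pair of indices.
\<close>

lemma sum_squares_of_areas:
  fixes c :: "3 \<Rightarrow> real^3"
  assumes a: "pos_weights a" and c: "\<And>i j. diag_form a (c i) (c j) = (if i = j then 1 else 0)"
  shows "(\<Sum>i\<in>UNIV. \<Sum>j\<in>UNIV. (diag_form s x (cross3 (c i) (c j)))\<^sup>2) =
    2 * ((s$1 * x$1)\<^sup>2 * a$1 + (s$2 * x$2)\<^sup>2 * a$2 + (s$3 * x$3)\<^sup>2 * a$3) / (a$1 * a$2 * a$3)"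
proof -
  have lin1: "bounded_linear (\<lambda>u. diag_form s x (cross3 u v))" for v
    by (rule bounded_linear_compose[OF bounded_bilinear.bounded_linear_right[OF bounded_bilinear_diag_form]
       bounded_bilinear.bounded_linear_left[OF bounded_bilinear_cross3]])
  have lin2: "bounded_linear (\<lambda>v. diag_form s x (cross3 u v))" for u
    by (rule bounded_linear_compose[OF bounded_bilinear.bounded_linear_right[OF bounded_bilinear_diag_form]
       bounded_bilinear.bounded_linear_right[OF bounded_bilinear_cross3]])
  have "(\<Sum>i\<in>UNIV. \<Sum>j\<in>UNIV. (diag_form s x (cross3 (c i) (c j)))\<^sup>2) =
      (\<Sum>i\<in>UNIV. \<Sum>l\<in>UNIV. (diag_form s x (cross3 (c i) (axis l 1)))\<^sup>2 / a$l)"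
    unfolding power2_eq_square
    by (intro sum.cong refl trace_orthonormal[OF a c bounded_bilinear.comp[OF bounded_bilinear_mult lin2 lin2]])
  also have "\<dots> = (\<Sum>l\<in>UNIV. (\<Sum>i\<in>UNIV. (diag_form s x (cross3 (c i) (axis l 1)))\<^sup>2) / a$l)"
    by (subst sum.swap) (simp only: sum_divide_distrib)
  also have "\<dots> = (\<Sum>l\<in>UNIV. (\<Sum>k\<in>UNIV. (diag_form s x (cross3 (axis k 1) (axis l 1)))\<^sup>2 / a$k) / a$l)"
    unfolding power2_eq_square
    by (simp only: trace_orthonormal[OF a c bounded_bilinear.comp[OF bounded_bilinear_mult lin1 lin1]])
  also have "\<dots> = 2 * ((s$1 * x$1)\<^sup>2 * a$1 + (s$2 * x$2)\<^sup>2 * a$2 + (s$3 * x$3)\<^sup>2 * a$3) / (a$1 * a$2 * a$3)"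
    using pos_weightsD[OF a, of 1] pos_weightsD[OF a, of 2] pos_weightsD[OF a, of 3]
    by (simp add: sum_3 diag_form_eq field_simps)
  finally show ?thesis .
qed

definition curv_norm :: "real^3 \<Rightarrow> real" where
  "curv_norm a = 2 * sqrt ((curv_coeff a $ 1 * a$1)\<^sup>2 + (curv_coeff a $ 2 * a$2)\<^sup>2 + (curv_coeff a $ 3 * a$3)\<^sup>2)
     / (a$1 * a$2 * a$3)"

lemma Rm_norm_left_metric:
  assumes a: "pos_weights a" and p: "p \<in> S3"
  shows "Rm_norm (left_metric a) p = curv_norm a"
proof -
  define e where "e = frame_at (left_metric a) p"
  have e: "orthonormal_frame (left_metric a) p e"
    unfolding e_def by (rule orthonormal_frame_frame_at[OF a p])
  have et: "e i \<in> tangent_space p" for i using e by (simp add: orthonormal_frame_def)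
  define c where "c i = coords p (e i)" for i
  have c: "diag_form a (c i) (c j) = (if i = j then 1 else 0)" for i j
    unfolding c_def by (rule orthonormal_frame_coords[OF e])
  define \<kappa> where "\<kappa> = curv_coeff a"
  define P where "P = a$1 * a$2 * a$3"
  have P: "P > 0" unfolding P_def using pos_weightsD[OF a] by simp
  define K where "K = (\<kappa>$1 * a$1)\<^sup>2 + (\<kappa>$2 * a$2)\<^sup>2 + (\<kappa>$3 * a$3)\<^sup>2"
  have area: "(\<Sum>i\<in>UNIV. \<Sum>j\<in>UNIV. (cross3 (c i) (c j) $ m)\<^sup>2) = 2 * a$m / P" for m
  proof -
    have "diag_form 1 (axis m 1) v = v $ m" for v
      by (simp add: diag_form_def axis_def if_distrib[of "\<lambda>x. _ * x"] if_distrib[of "\<lambda>x. x * _"] cong: if_cong)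
    moreover have "m = 1 \<or> m = 2 \<or> m = 3" by (rule exhaust_3)
    ultimately show ?thesis using sum_squares_of_areas[OF a c, of 1 "axis m 1"] by (auto simp: P_def)
  qed
  have "(\<Sum>i\<in>UNIV. \<Sum>j\<in>UNIV. \<Sum>k\<in>UNIV. \<Sum>l\<in>UNIV. (Rm (left_metric a) p (e i) (e j) (e k) (e l))\<^sup>2) =
    (\<Sum>i\<in>UNIV. \<Sum>j\<in>UNIV. \<Sum>k\<in>UNIV. \<Sum>l\<in>UNIV. (diag_form \<kappa> (cross3 (c i) (c j)) (cross3 (c k) (c l)))\<^sup>2)"
    unfolding Rm_left_metric[OF a p et et] power2_minus c_def \<kappa>_def ..
  also have "\<dots> = (\<Sum>i\<in>UNIV. \<Sum>j\<in>UNIV. (2 * (\<kappa>$1)\<^sup>2 * a$1 / P) * (cross3 (c i) (c j) $ 1)\<^sup>2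
      + (2 * (\<kappa>$2)\<^sup>2 * a$2 / P) * (cross3 (c i) (c j) $ 2)\<^sup>2 + (2 * (\<kappa>$3)\<^sup>2 * a$3 / P) * (cross3 (c i) (c j) $ 3)\<^sup>2)"
    unfolding sum_squares_of_areas[OF a c] P_def[symmetric]
    by (simp only: power_mult_distrib add_divide_distrib distrib_left) (simp only: ac_simps times_divide_eq_left times_divide_eq_right)
  also have "\<dots> = (2 * (\<kappa>$1)\<^sup>2 * a$1 / P) * (2 * a$1 / P) + (2 * (\<kappa>$2)\<^sup>2 * a$2 / P) * (2 * a$2 / P)
      + (2 * (\<kappa>$3)\<^sup>2 * a$3 / P) * (2 * a$3 / P)"
    by (simp only: sum.distrib sum_distrib_left[symmetric] area)
  also have "\<dots> = (2 / P)\<^sup>2 * K"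
    unfolding K_def using P by (simp add: power2_eq_square field_simps)
  finally have "Rm_norm (left_metric a) p = sqrt ((2 / P)\<^sup>2 * K)"
    unfolding Rm_norm_def Let_def e_def by simp
  also have "\<dots> = curv_norm a"
    using P unfolding curv_norm_def K_def \<kappa>_def[symmetric] P_def[symmetric] by (simp add: real_sqrt_mult)
  finally show ?thesis .
qed

lemma curv_coeff_scaleR:
  assumes "r > 0" "pos_weights a"
  shows "curv_coeff (r *\<^sub>R a) $ i = r * curv_coeff a $ i"
  using exhaust_3[of i] assms(1) pos_weightsD[OF assms(2), of 1] pos_weightsD[OF assms(2), of 2] pos_weightsD[OF assms(2), of 3]
  by (auto simp: field_simps)

lemma curv_norm_scaleR:
  assumes "r > 0" "pos_weights a"
  shows "curv_norm (r *\<^sub>R a) = curv_norm a / r"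
proof -
  let ?K = "(curv_coeff a $ 1 * a$1)\<^sup>2 + (curv_coeff a $ 2 * a$2)\<^sup>2 + (curv_coeff a $ 3 * a$3)\<^sup>2"
  have "(curv_coeff (r *\<^sub>R a) $ 1 * (r *\<^sub>R a)$1)\<^sup>2 + (curv_coeff (r *\<^sub>R a) $ 2 * (r *\<^sub>R a)$2)\<^sup>2
    + (curv_coeff (r *\<^sub>R a) $ 3 * (r *\<^sub>R a)$3)\<^sup>2 = (r\<^sup>2)\<^sup>2 * ?K"
    unfolding curv_coeff_scaleR[OF assms]
    by (simp add: power2_eq_square algebra_simps del: curv_coeff_nth)
  then have "curv_norm (r *\<^sub>R a) = 2 * (r\<^sup>2 * sqrt ?K) / ((r * a$1) * (r * a$2) * (r * a$3))"
    unfolding curv_norm_def by (simp only: real_sqrt_mult real_sqrt_abs abs_power2 vector_scaleR_component real_scaleR_def)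
  also have "\<dots> = (r * (r * (2 * sqrt ?K))) / (r * (r * (r * (a$1 * a$2 * a$3))))"
    by (simp only: power2_eq_square ac_simps)
  also have "\<dots> = curv_norm a / r"
    using assms unfolding curv_norm_def by (simp add: mult.commute del: curv_coeff_nth)
  finally show ?thesis .
qed

section \<open>Homogeneity\<close>

lemma homogeneous_left_metric: "homogeneous (left_metric a)"
  unfolding homogeneous_def
proof (intro ballI)
  fix p q assume p: "p \<in> S3" and q: "q \<in> S3"
  \<comment> \<open>Left multiplication by \<open>q * conj p\<close> moves \<open>p\<close> to \<open>q\<close>.\<close>
  define r where "r = qmult q (qconj p)"
  have r1: "r \<bullet> r = 1"
    unfolding r_def inner_qmult inner_qconj using p q by simp
  have rc1: "qconj r \<bullet> qconj r = 1" using r1 by (simp only: inner_qconj)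
  have map: "qmult s x \<in> S3" if "s \<bullet> s = 1" "x \<in> S3" for s x
  proof -
    have "qmult s x \<bullet> qmult s x = 1" unfolding inner_qmult using that by simp
    then show ?thesis by (simp add: norm_eq_sqrt_inner)
  qed
  have inv1: "qmult (qconj r) (qmult r x) = x" and inv2: "qmult r (qmult (qconj r) x) = x" for x
    unfolding qmult_inverse r1 by simp_all
  have lin: "bounded_linear (qmult s)" for s
    by (rule bounded_bilinear.bounded_linear_right[OF bounded_bilinear_qmult])
  have bij: "bij_betw (qmult r) S3 S3"
    by (rule bij_betw_byWitness[where f' = "qmult (qconj r)"]) (use inv1 inv2 map r1 rc1 in auto)
  have "inv_into S3 (qmult r) y = qmult (qconj r) y" if "y \<in> S3" for y
    by (rule inv_into_f_eq[OF bij_betw_imp_inj_on[OF bij] map[OF rc1 that] inv2])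
  then have "smooth_on S3 (inv_into S3 (qmult r))"
    using smooth_on_cong[OF smooth_on_bounded_linear[OF lin[of "qconj r"]]] by metis
  then have "diffeomorphism (qmult r)"
    unfolding diffeomorphism_def using bij smooth_on_bounded_linear[OF lin] by blast
  moreover have "left_metric a (qmult r x) (dS3 (qmult r) x u) (dS3 (qmult r) x v) = left_metric a x u v"
    if "x \<in> S3" "u \<in> tangent_space x" "v \<in> tangent_space x" for x u v
    unfolding left_metric_def dS3_linear[OF lin that(1,2)] dS3_linear[OF lin that(1,3)]
      coords_left_translation r1 by simp
  ultimately have "qmult r \<in> isometries (left_metric a)"
    unfolding isometries_def by blast
  moreover have "qmult r p = q"
    unfolding r_def qmult_assoc qmult_qconj_right using p by simp
  ultimately show "\<exists>\<phi>\<in>isometries (left_metric a). \<phi> p = q" by blast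
qed

section \<open>Ricci flow of left-invariant metrics\<close>

lemma Ck_on_real_SucI:
  fixes f :: "real \<Rightarrow> real"
  assumes "\<And>t. t \<in> U \<Longrightarrow> (f has_real_derivative f' t) (at t)" "Ck_on k f' U"
  shows "Ck_on (Suc k) f U"
  unfolding Ck_on.simps
  using assms Ck_on_bilinear[OF bounded_bilinear_mult assms(2) Ck_on_const]
  by (intro exI[of _ "\<lambda>t h. f' t * h"]) (auto simp: has_field_derivative_def)

lemmas Ck_on_mult = Ck_on_bilinear[OF bounded_bilinear_mult]

lemma Ck_on_minus: "Ck_on k f U \<Longrightarrow> Ck_on k (\<lambda>x. - f x) U"
  by (rule Ck_on_linear_compose[OF bounded_linear_minus[OF bounded_linear_ident]])

text \<open>
  Adjoining the reciprocal of the product of the three coefficients turns the flow equations into a polynomial system, so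
  differentiability of order \<open>k\<close> of its solutions implies that of order \<open>k + 1\<close>.
\<close>

lemma ricci_ode_smooth:
  fixes f g h d :: "real \<Rightarrow> real"
  assumes f: "\<And>t. t \<in> U \<Longrightarrow> (f has_real_derivative - (4 * ((f t * f t - (g t - h t) * (g t - h t)) * (f t * d t)))) (at t)"
    and g: "\<And>t. t \<in> U \<Longrightarrow> (g has_real_derivative - (4 * ((g t * g t - (h t - f t) * (h t - f t)) * (g t * d t)))) (at t)"
    and h: "\<And>t. t \<in> U \<Longrightarrow> (h has_real_derivative - (4 * ((h t * h t - (f t - g t) * (f t - g t)) * (h t * d t)))) (at t)"
    and d: "\<And>t. t \<in> U \<Longrightarrow> (d has_real_derivative 4 * ((f t * f t - (g t - h t) * (g t - h t)
       + (g t * g t - (h t - f t) * (h t - f t)) + (h t * h t - (f t - g t) * (f t - g t))) * (d t * d t))) (at t)"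
  shows "Ck_on k f U \<and> Ck_on k g U \<and> Ck_on k h U \<and> Ck_on k d U"
proof (induction k)
  case 0
  have "continuous_on U w" if "\<And>t. t \<in> U \<Longrightarrow> (w has_real_derivative w' t) (at t)" for w w' :: "real \<Rightarrow> real"
    using that DERIV_isCont continuous_at_imp_continuous_on by blast
  from this[OF f] this[OF g] this[OF h] this[OF d] show ?case by simp
next
  case (Suc k)
  then have C: "Ck_on k f U" "Ck_on k g U" "Ck_on k h U" "Ck_on k d U" by auto
  have D: "Ck_on k (\<lambda>t. x t - y t) U" if "Ck_on k x U" "Ck_on k y U" for x y :: "real \<Rightarrow> real"
    using Ck_on_add[OF that(1) Ck_on_minus[OF that(2)]] by simp
  have S: "Ck_on k (\<lambda>t. x t * x t - (y t - z t) * (y t - z t)) U"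
    if "Ck_on k x U" "Ck_on k y U" "Ck_on k z U" for x y z :: "real \<Rightarrow> real"
    by (intro D Ck_on_mult that)
  have E: "Ck_on k (\<lambda>t. - (4 * ((x t * x t - (y t - z t) * (y t - z t)) * (x t * d t)))) U"
    if "Ck_on k x U" "Ck_on k y U" "Ck_on k z U" for x y z :: "real \<Rightarrow> real"
    by (rule Ck_on_minus) (intro Ck_on_mult Ck_on_const S that C)
  have "Ck_on (Suc k) f U" by (rule Ck_on_real_SucI[OF f E[OF C(1,2,3)]])
  moreover have "Ck_on (Suc k) g U" by (rule Ck_on_real_SucI[OF g E[OF C(2,3,1)]])
  moreover have "Ck_on (Suc k) h U" by (rule Ck_on_real_SucI[OF h E[OF C(3,1,2)]])
  moreover have "Ck_on (Suc k) d U"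
    by (rule Ck_on_real_SucI[OF d Ck_on_mult[OF Ck_on_const Ck_on_mult[OF
        Ck_on_add[OF Ck_on_add[OF S[OF C(1,2,3)] S[OF C(2,3,1)]] S[OF C(3,1,2)]] Ck_on_mult[OF C(4,4)]]]])
  ultimately show ?case by blast
qed

text \<open>
  The flow equations are required on an open set of times. When it contains the interval
  \<open>[0,T)\<close>, the coefficients have smooth extensions to negative times, as smoothness up to the
  initial time demands.
\<close>

lemma ricci_ode_solution_smooth:
  fixes a :: "real \<Rightarrow> real^3"
  assumes pos: "\<And>t. t \<in> U \<Longrightarrow> pos_weights (a t)"
    and ode: "\<And>t i. t \<in> U \<Longrightarrow> ((\<lambda>t. a t $ i) has_real_derivative - 2 * ricci_coeff (a t) $ i) (at t)"
  shows "Ck_on k (\<lambda>t. a t $ i) U"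
proof -
  define d where "d t = 1 / (a t $ 1 * a t $ 2 * a t $ 3)" for t
  have nz: "a t $ 1 \<noteq> 0" "a t $ 2 \<noteq> 0" "a t $ 3 \<noteq> 0" if "t \<in> U" for t
    using pos_weightsD[OF pos[OF that]] less_irrefl by metis+
  let ?F = "\<lambda>x y z::real. x * x - (y - z) * (y - z)"
  have D: "((\<lambda>t. a t $ 1) has_real_derivative - (4 * (?F (a t $ 1) (a t $ 2) (a t $ 3) * (a t $ 1 * d t)))) (at t)"
    "((\<lambda>t. a t $ 2) has_real_derivative - (4 * (?F (a t $ 2) (a t $ 3) (a t $ 1) * (a t $ 2 * d t)))) (at t)"
    "((\<lambda>t. a t $ 3) has_real_derivative - (4 * (?F (a t $ 3) (a t $ 1) (a t $ 2) * (a t $ 3 * d t)))) (at t)"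
    if "t \<in> U" for t
    by (rule DERIV_cong[OF ode[OF that]], use nz[OF that] in \<open>simp add: d_def power2_eq_square field_simps\<close>)+
  have "(d has_real_derivative 4 * ((?F (a t $ 1) (a t $ 2) (a t $ 3) + ?F (a t $ 2) (a t $ 3) (a t $ 1)
       + ?F (a t $ 3) (a t $ 1) (a t $ 2)) * (d t * d t))) (at t)" if t: "t \<in> U" for t
  proof -
    have "((\<lambda>t. a t $ 1 * a t $ 2 * a t $ 3) has_real_derivative
      - (4 * (?F (a t $ 1) (a t $ 2) (a t $ 3) + ?F (a t $ 2) (a t $ 3) (a t $ 1)
       + ?F (a t $ 3) (a t $ 1) (a t $ 2)))) (at t)"
      by (rule DERIV_cong[OF DERIV_mult[OF DERIV_mult[OF D(1,2)[OF t]] D(3)[OF t]]])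
         (use nz[OF t] in \<open>simp add: d_def field_simps\<close>)
    then have "((\<lambda>t. inverse (a t $ 1 * a t $ 2 * a t $ 3)) has_real_derivative
      - (d t * - (4 * (?F (a t $ 1) (a t $ 2) (a t $ 3) + ?F (a t $ 2) (a t $ 3) (a t $ 1)
       + ?F (a t $ 3) (a t $ 1) (a t $ 2))) * d t)) (at t)"
      unfolding d_def inverse_eq_divide[symmetric] by (rule DERIV_inverse') (use nz[OF t] in simp)
    then show ?thesis
      unfolding d_def[abs_def] inverse_eq_divide[symmetric] by (rule DERIV_cong) algebra
  qed
  from ricci_ode_smooth[of U "\<lambda>t. a t $ 1" "\<lambda>t. a t $ 2" "\<lambda>t. a t $ 3" d k, OF D this]
  have "Ck_on k (\<lambda>t. a t $ 1) U \<and> Ck_on k (\<lambda>t. a t $ 2) U \<and> Ck_on k (\<lambda>t. a t $ 3) U" by blast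
  then show ?thesis using exhaust_3[of i] by auto
qed

text \<open>
  The Ricci tensor of a diagonal left-invariant metric is of the same kind, so the flow preserves
  this class and reduces to three ordinary differential equations.
\<close>

lemma ricci_flow_left_metric:
  fixes a :: "real \<Rightarrow> real^3"
  assumes U: "open U" "{0..<T} \<subseteq> U" and pos: "\<And>t. t \<in> U \<Longrightarrow> pos_weights (a t)"
    and ode: "\<And>t i. t \<in> U \<Longrightarrow> ((\<lambda>t. a t $ i) has_real_derivative - 2 * ricci_coeff (a t) $ i) (at t)"
  shows "ricci_flow T (\<lambda>t. left_metric (a t))"
  unfolding ricci_flow_def
proof (intro conjI ballI)
  fix t assume "t \<in> {0..<T}"
  then show "riemannian_metric (left_metric (a t))" using U pos riemannian_metric_left_metric by blast
next
  fix X Y assume X: "X \<in> vector_fields" and Y: "Y \<in> vector_fields"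
  have A: "smooth_on {0..<T} (\<lambda>t. a t $ i)" for i
    unfolding smooth_on_def using U ricci_ode_solution_smooth[OF pos ode] by blast
  have S: "smooth_on S3 (\<lambda>p. coords p (Z p) $ i)" if "Z \<in> vector_fields" for Z i
    using smooth_on_linear_compose[OF bounded_linear_vec_nth smooth_on_coords[OF vector_fields_smooth[OF that]]] .
  have "smooth_on ({0..<T} \<times> S3) (\<lambda>z. \<Sum>i\<in>UNIV. a (fst z) $ i * (coords (snd z) (X (snd z)) $ i * coords (snd z) (Y (snd z)) $ i))"
  proof (intro smooth_on_sum finite)
    fix i :: 3
    have "smooth_on ({0..<T} \<times> S3) (\<lambda>z. a (fst z) $ i)"
      by (rule smooth_on_compose_linear[OF bounded_linear_fst _ A]) auto
    moreover have "smooth_on ({0..<T} \<times> S3) (\<lambda>z. coords (snd z) (X (snd z)) $ i * coords (snd z) (Y (snd z)) $ i)"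
      by (rule smooth_on_compose_linear[OF bounded_linear_snd _
         smooth_on_bilinear[OF bounded_bilinear_mult S[OF X] S[OF Y]]]) auto
    ultimately show "smooth_on ({0..<T} \<times> S3)
      (\<lambda>z. a (fst z) $ i * (coords (snd z) (X (snd z)) $ i * coords (snd z) (Y (snd z)) $ i))"
      by (rule smooth_on_bilinear[OF bounded_bilinear_mult])
  qed
  then show "smooth_on ({0..<T} \<times> S3) (\<lambda>(t, p). left_metric (a t) p (X p) (Y p))"
    by (simp only: left_metric_def diag_form_def case_prod_unfold mult.assoc)
next
  fix t p u v assume t: "t \<in> {0..<T}" and p: "p \<in> S3" and u: "u \<in> tangent_space p"
  have tU: "t \<in> U" using t U by blast
  have "((\<lambda>s. \<Sum>i\<in>UNIV. a s $ i * coords p u $ i * coords p v $ i) has_real_derivative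
     (\<Sum>i\<in>UNIV. - 2 * ricci_coeff (a t) $ i * coords p u $ i * coords p v $ i)) (at t within {0..<T})"
    by (intro DERIV_sum DERIV_cmult_right has_field_derivative_at_within[OF ode[OF tU]])
  then show "((\<lambda>s. left_metric (a s) p u v) has_real_derivative - 2 * Ric (left_metric (a t)) p u v) (at t within {0..<T})"
    unfolding Ric_left_metric[OF pos[OF tU] p u] left_metric_def diag_form_def
    by (simp only: sum_distrib_left mult.assoc)
qed

text \<open>
  A flow that continued beyond \<open>T\<close> would have a nondegenerate metric at time \<open>T\<close>, which is the limit
  of the metrics at earlier times.
\<close>

lemma extinction_time_left_metric:
  fixes a :: "real \<Rightarrow> real^3"
  assumes T: "0 < T" and flow: "ricci_flow T (\<lambda>t. left_metric (a t))"
    and lim: "((\<lambda>t. a t $ 1) \<longlongrightarrow> 0) (at_left T)"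
  shows "extinction_time (\<lambda>t. left_metric (a t)) T"
  unfolding extinction_time_def
proof (intro conjI T flow notI)
  assume "\<exists>T'>T. \<exists>h. ricci_flow T' h \<and>
          (\<forall>t\<in>{0..<T}. \<forall>p\<in>S3. \<forall>u\<in>tangent_space p. \<forall>v\<in>tangent_space p. h t p u v = left_metric (a t) p u v)"
  then obtain T' h where T': "T < T'" and h: "ricci_flow T' h"
    and eq: "\<forall>t\<in>{0..<T}. \<forall>p\<in>S3. \<forall>u\<in>tangent_space p. \<forall>v\<in>tangent_space p. h t p u v = left_metric (a t) p u v"
    by blast
  define p :: R4 where "p = axis 1 1"
  define u where "u = left_field p (axis 1 1)"
  have p: "p \<in> S3" by (simp add: p_def)
  have u: "u \<in> tangent_space p" unfolding u_def by (rule left_field_tangent)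
  have cu: "coords p u = axis 1 1" unfolding u_def by (rule coords_left_field_S3[OF p])
  have u0: "u \<noteq> 0"
    using cu coords_eq_0_iff[OF p u] by (metis axis_eq_0_iff one_neq_zero)
  have TT: "T \<in> {0..<T'}" using T T' by simp
  have "inner_product_on (tangent_space p) (h T p)"
    using h TT p unfolding ricci_flow_def riemannian_metric_def by blast
  then have pos: "h T p u u > 0" using u u0 unfolding inner_product_on_def by blast
  have "((\<lambda>s. h s p u u) has_real_derivative (- 2 * Ric (h T) p u u)) (at T within {0..<T'})"
    using h TT p u unfolding ricci_flow_def by blast
  then have "((\<lambda>s. h s p u u) \<longlongrightarrow> h T p u u) (at T within {0..<T'})"
    using DERIV_continuous continuous_within by blast
  then have "((\<lambda>s. h s p u u) \<longlongrightarrow> h T p u u) (at T within {0..T})"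
    by (rule tendsto_within_subset) (use T' in auto)
  then have "((\<lambda>s. h s p u u) \<longlongrightarrow> h T p u u) (at_left T)"
    using T by (simp add: at_within_Icc_at_left)
  moreover have "\<forall>\<^sub>F s in at_left T. h s p u u = a s $ 1"
    using eventually_at_left_real[OF T]
  proof eventually_elim
    case (elim s)
    then have "h s p u u = left_metric (a s) p u u" using eq p u by auto
    also have "\<dots> = a s $ 1" unfolding left_metric_def cu by (simp add: diag_form_eq)
    finally show ?case .
  qed
  ultimately have "((\<lambda>t. a t $ 1) \<longlongrightarrow> h T p u u) (at_left T)"
    by (simp add: tendsto_cong)
  then have "h T p u u = 0" using lim by (intro tendsto_unique[of "at_left T"]) auto
  then show False using pos by simp
qed

section \<open>An existence theorem for scalar differential equations\<close>

lemma antiderivative_exists: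
  fixes g :: "real \<Rightarrow> real"
  assumes "continuous_on UNIV g"
  shows "\<exists>F. F 0 = 0 \<and> (\<forall>t. (F has_real_derivative g t) (at t))"
proof -
  have "\<exists>F. \<forall>x. - \<infinity> < ereal x \<longrightarrow> ereal x < \<infinity> \<longrightarrow> (F has_vector_derivative g x) (at x)"
    using assms by (intro einterval_antiderivative) (auto simp: continuous_on_eq_continuous_at)
  then obtain F where "\<And>x. (F has_real_derivative g x) (at x)"
    by (auto simp: has_real_derivative_iff_has_vector_derivative)
  then show ?thesis by (intro exI[of _ "\<lambda>t. F t - F 0"]) (auto intro!: derivative_eq_intros)
qed

lemma continuous_on_of_has_real_derivative:
  fixes f :: "real \<Rightarrow> real"
  assumes "\<And>s. (f has_real_derivative f' s) (at s)"
  shows "continuous_on UNIV f"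
proof (rule continuous_at_imp_continuous_on, rule ballI)
  show "isCont f s" for s by (rule DERIV_isCont[OF assms])
qed

lemma nondecreasing_of_deriv_nonneg:
  fixes f :: "real \<Rightarrow> real"
  assumes "a \<le> b" "\<And>x. a \<le> x \<Longrightarrow> x \<le> b \<Longrightarrow> (f has_real_derivative f' x) (at x)"
    "\<And>x. a \<le> x \<Longrightarrow> x \<le> b \<Longrightarrow> f' x \<ge> 0"
  shows "f a \<le> f b"
proof (rule DERIV_nonneg_imp_nondecreasing[OF assms(1)])
  fix x assume "a \<le> x" "x \<le> b"
  then show "\<exists>y. (f has_real_derivative y) (at x) \<and> 0 \<le> y"
    by (intro exI[of _ "f' x"] conjI assms(2,3))
qed

text \<open>Integrating an exponential bound divides it by the rate; this is the estimate behind the contraction below.\<close>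

lemma exp_growth_bound:
  fixes h :: "real \<Rightarrow> real"
  assumes K: "K > 0" and h: "h 0 = 0" "\<And>t. (h has_real_derivative g t) (at t)"
    and g: "\<And>t. \<bar>g t\<bar> \<le> C * exp (K * \<bar>t\<bar>)"
  shows "\<bar>h t\<bar> \<le> C / K * exp (K * \<bar>t\<bar>)"
proof -
  have C: "C \<ge> 0" using g[of 0] by simp
  have main: "h t \<le> C / K * exp (K * t)"
    if t: "t \<ge> 0" and h: "h 0 = 0" "\<And>t. (h has_real_derivative g t) (at t)"
      and g: "\<And>t. \<bar>g t\<bar> \<le> C * exp (K * \<bar>t\<bar>)" for t g and h :: "real \<Rightarrow> real"
  proof -
    have "C / K * exp (K * 0) - h 0 \<le> C / K * exp (K * t) - h t"
    proof (rule nondecreasing_of_deriv_nonneg[OF t, where f' = "\<lambda>s. C * exp (K * s) - g s"])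
      fix s :: real assume s: "0 \<le> s"
      show "((\<lambda>s. C / K * exp (K * s) - h s) has_real_derivative C * exp (K * s) - g s) (at s)"
        using K by (auto intro!: derivative_eq_intros h(2))
      show "C * exp (K * s) - g s \<ge> 0" using g[of s] s by simp
    qed
    moreover have "C / K * exp (K * 0) \<ge> 0" using C K by simp
    ultimately show ?thesis using h(1) by linarith
  qed
  have neg: "((\<lambda>t. - h t) has_real_derivative - g t) (at t)" for t
    by (rule DERIV_minus[OF h(2)])
  have mir: "((\<lambda>t. h (- t)) has_real_derivative - g (- t)) (at t)" for t
    using DERIV_chain2[of h "g (- t)" uminus t "-1" UNIV, OF h(2) DERIV_minus[OF DERIV_ident]] by simp
  have negmir: "((\<lambda>t. - h (- t)) has_real_derivative g (- t)) (at t)" for t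
    using DERIV_minus[OF mir] by simp
  have g': "\<bar>- g t\<bar> \<le> C * exp (K * \<bar>t\<bar>)" "\<bar>- g (- t)\<bar> \<le> C * exp (K * \<bar>t\<bar>)"
    "\<bar>g (- t)\<bar> \<le> C * exp (K * \<bar>t\<bar>)" for t
    using g[of t] g[of "-t"] by simp_all
  show ?thesis
  proof (cases "t \<ge> 0")
    case True
    have "h t \<le> C / K * exp (K * t)" by (rule main[of t h g, OF True h g])
    moreover have "- h t \<le> C / K * exp (K * t)"
      by (rule main[of t "\<lambda>t. - h t" "\<lambda>t. - g t", OF True _ neg g'(1)]) (simp add: h(1))
    ultimately show ?thesis using True by simp
  next
    case False
    then have t: "0 \<le> - t" by simp
    have "h (- (- t)) \<le> C / K * exp (K * (- t))"
      by (rule main[of "- t" "\<lambda>t. h (- t)" "\<lambda>t. - g (- t)", OF t _ mir g'(2)]) (simp add: h(1))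
    moreover have "- h (- (- t)) \<le> C / K * exp (K * (- t))"
      by (rule main[of "- t" "\<lambda>t. - h (- t)" "\<lambda>t. g (- t)", OF t _ negmir g'(3)]) (simp add: h(1))
    ultimately show ?thesis using False by simp
  qed
qed

text \<open>
  Picard iteration on the whole line at once. Writing the solution as
  \<open>u0 + exp (2 * L * \<bar>t\<bar>) * v t\<close> with a bounded unknown \<open>v\<close>, the exponential weight halves the
  distance of any two candidates in the supremum norm, so there is no need to glue local solutions.
\<close>

lemma scalar_ode_solution_exists:
  fixes f :: "real \<Rightarrow> real \<Rightarrow> real"
  assumes cont: "continuous_on UNIV (\<lambda>z. f (fst z) (snd z))"
    and L: "L > 0" "\<And>t x y. \<bar>f t x - f t y\<bar> \<le> L * \<bar>x - y\<bar>"
    and M: "\<And>t x. \<bar>f t x\<bar> \<le> M"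
  shows "\<exists>u. u 0 = u0 \<and> (\<forall>t. (u has_real_derivative f t (u t)) (at t))"
proof -
  define K where "K = 2 * L"
  have K: "K > 0" using L(1) by (simp add: K_def)
  define G where "G v t = f t (u0 + exp (K * \<bar>t\<bar>) * apply_bcontfun v t)" for v :: "real \<Rightarrow>\<^sub>C real" and t
  have "continuous_on UNIV (G v)" for v
  proof -
    have "continuous_on UNIV (\<lambda>t. (t, u0 + exp (K * \<bar>t\<bar>) * apply_bcontfun v t))"
      by (intro continuous_intros continuous_on_apply_bcontfun)
    from continuous_on_compose2[OF cont this] show ?thesis by (simp add: G_def[abs_def])
  qed
  then have ex: "\<exists>F. F 0 = 0 \<and> (\<forall>t. (F has_real_derivative G v t) (at t))" for v
    by (rule antiderivative_exists)
  define F where "F v = (SOME F. F 0 = 0 \<and> (\<forall>t. (F has_real_derivative G v t) (at t)))" for v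
  have F: "F v 0 = 0" "(F v has_real_derivative G v t) (at t)" for v t
    using someI_ex[OF ex[of v]] unfolding F_def[of v, symmetric] by auto
  have M0: "M \<ge> 0" using M[of 0 0] by simp
  have FM: "\<bar>F v t\<bar> \<le> M / K * exp (K * \<bar>t\<bar>)" for v t
  proof (rule exp_growth_bound[OF K F])
    fix s
    have "\<bar>G v s\<bar> \<le> M * 1" using M by (simp add: G_def)
    also have "\<dots> \<le> M * exp (K * \<bar>s\<bar>)" using M0 K by (intro mult_left_mono) auto
    finally show "\<bar>G v s\<bar> \<le> M * exp (K * \<bar>s\<bar>)" .
  qed
  have "(\<lambda>t. exp (- (K * \<bar>t\<bar>)) * F v t) \<in> bcontfun" for v
  proof (rule bcontfun_normI[where b = "M / K"])
    have "continuous_on UNIV (F v)" by (rule continuous_on_of_has_real_derivative) (rule F(2))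
    then show "continuous_on UNIV (\<lambda>t. exp (- (K * \<bar>t\<bar>)) * F v t)" by (intro continuous_intros)
    show "norm (exp (- (K * \<bar>t\<bar>)) * F v t) \<le> M / K" for t
      using FM[of v t] by (simp add: abs_mult exp_minus field_simps)
  qed
  note bounded = this
  define \<Phi> where "\<Phi> v = Bcontfun (\<lambda>t. exp (- (K * \<bar>t\<bar>)) * F v t)" for v
  have \<Phi>: "apply_bcontfun (\<Phi> v) t = exp (- (K * \<bar>t\<bar>)) * F v t" for v t
    unfolding \<Phi>_def Bcontfun_inverse[OF bounded] ..
  have "dist (\<Phi> v) (\<Phi> w) \<le> 1/2 * dist v w" for v w
  proof (rule dist_bound)
    fix t
    have "\<bar>F v t - F w t\<bar> \<le> (L * dist v w) / K * exp (K * \<bar>t\<bar>)"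
    proof (rule exp_growth_bound[OF K])
      show "F v 0 - F w 0 = 0" using F(1) by simp
      show "((\<lambda>t. F v t - F w t) has_real_derivative G v s - G w s) (at s)" for s
        by (rule DERIV_diff[OF F(2) F(2)])
      fix s
      have "\<bar>G v s - G w s\<bar> \<le> L * \<bar>exp (K * \<bar>s\<bar>) * apply_bcontfun v s - exp (K * \<bar>s\<bar>) * apply_bcontfun w s\<bar>"
        using L(2)[of s "u0 + exp (K * \<bar>s\<bar>) * apply_bcontfun v s" "u0 + exp (K * \<bar>s\<bar>) * apply_bcontfun w s"]
        by (simp add: G_def)
      also have "\<dots> = L * dist (apply_bcontfun v s) (apply_bcontfun w s) * exp (K * \<bar>s\<bar>)"
        by (simp add: right_diff_distrib[symmetric] abs_mult dist_real_def)
      also have "\<dots> \<le> L * dist v w * exp (K * \<bar>s\<bar>)"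
        using L(1) dist_bounded[of v s w] by (intro mult_right_mono mult_left_mono) auto
      finally show "\<bar>G v s - G w s\<bar> \<le> L * dist v w * exp (K * \<bar>s\<bar>)" .
    qed
    then have b: "\<bar>F v t - F w t\<bar> \<le> 1/2 * dist v w * exp (K * \<bar>t\<bar>)"
      using L(1) by (simp add: K_def)
    have "dist (apply_bcontfun (\<Phi> v) t) (apply_bcontfun (\<Phi> w) t) = exp (- (K * \<bar>t\<bar>)) * \<bar>F v t - F w t\<bar>"
      unfolding \<Phi> dist_real_def right_diff_distrib[symmetric] abs_mult by simp
    also have "\<dots> \<le> exp (- (K * \<bar>t\<bar>)) * (1/2 * dist v w * exp (K * \<bar>t\<bar>))"
      using b by (intro mult_left_mono) auto
    also have "\<dots> = 1/2 * dist v w" by (simp add: exp_minus)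
    finally show "dist (apply_bcontfun (\<Phi> v) t) (apply_bcontfun (\<Phi> w) t) \<le> 1/2 * dist v w" .
  qed
  then obtain v where v: "\<Phi> v = v" using banach_fix_type[of "1/2" \<Phi>] by auto
  have "exp (K * \<bar>t\<bar>) * apply_bcontfun v t = F v t" for t
    using \<Phi>[of v t] unfolding v by (simp add: exp_minus field_simps)
  then have "G v t = f t (u0 + F v t)" for t by (simp add: G_def)
  then have "((\<lambda>t. u0 + F v t) has_real_derivative f t (u0 + F v t)) (at t)" for t
    using F(2)[of v t] by (auto intro!: derivative_eq_intros)
  then show ?thesis using F(1) by (intro exI[of _ "\<lambda>t. u0 + F v t"]) auto
qed

section \<open>The flow of the shape\<close>

definition logistic :: "real \<Rightarrow> real" where
  "logistic x = 1 / (1 + exp (- x))"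

lemma exp_plus_one_pos: "1 + exp (x::real) > 0"
  by (simp add: add_pos_pos)

lemma logistic_gt_0: "logistic x > 0" and logistic_lt_1: "logistic x < 1"
  using exp_plus_one_pos[of "-x"] by (simp_all add: logistic_def)

lemma logistic_has_derivative:
  "(logistic has_real_derivative logistic x * (1 - logistic x)) (at x)"
  using exp_plus_one_pos[of "-x"] unfolding logistic_def[abs_def]
  by (auto intro!: derivative_eq_intros simp: field_simps power2_eq_square)

lemma logistic_lipschitz: "\<bar>logistic x - logistic y\<bar> \<le> \<bar>x - y\<bar>"
proof -
  have "norm (logistic x - logistic y) \<le> 1 * norm (x - y)"
  proof (rule field_differentiable_bound[OF convex_UNIV])
    show "(logistic has_field_derivative logistic z * (1 - logistic z)) (at z within UNIV)" for z
      by (rule logistic_has_derivative)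
    have "logistic z * (1 - logistic z) \<le> 1 * 1" for z
      using logistic_gt_0[of z] logistic_lt_1[of z] by (intro mult_mono) auto
    then show "norm (logistic z * (1 - logistic z)) \<le> 1" for z
      using logistic_gt_0[of z] logistic_lt_1[of z] by (simp add: abs_mult)
  qed auto
  then show ?thesis by simp
qed

lemma logistic_surj: "0 < y \<Longrightarrow> y < 1 \<Longrightarrow> \<exists>x. logistic x = y"
proof -
  assume y: "0 < y" "y < 1"
  then have e: "exp (- ln (y / (1 - y))) = (1 - y) / y" by (simp add: exp_minus)
  have "logistic (ln (y / (1 - y))) = y" unfolding logistic_def e using y by (simp add: field_simps)
  then show ?thesis by blast
qed

text \<open>
  With \<open>y = a$2 / a$1\<close>, \<open>z = a$3 / a$1\<close> and the time \<open>s\<close> determined by \<open>dt = (a$1 * y * z / 8) ds\<close>, the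
  Ricci flow becomes the planar system below. In the logistic coordinates \<open>y = logistic p\<close> and
  \<open>z = logistic q\<close> it reads \<open>p' = 1 + y - z\<close> and \<open>q' = 1 + z - y\<close>. The sum \<open>p + q\<close> grows at the constant
  speed 2, and half the difference, \<open>w\<close>, satisfies a scalar equation whose right-hand side is bounded
  and Lipschitz in \<open>w\<close>. Hence the solutions exist for all \<open>s\<close>.
\<close>

lemma shape_flow_exists:
  fixes y0 z0 :: real
  assumes "0 < y0" "y0 < 1" "0 < z0" "z0 < 1"
  obtains y z :: "real \<Rightarrow> real" where "y 0 = y0" "z 0 = z0"
    "\<And>s. 0 < y s" "\<And>s. y s < 1" "\<And>s. 0 < z s" "\<And>s. z s < 1"
    "\<And>s. (y has_real_derivative y s * (1 - y s) * (1 + y s - z s)) (at s)"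
    "\<And>s. (z has_real_derivative z s * (1 - z s) * (1 + z s - y s)) (at s)"
proof -
  obtain p q where pq: "logistic p = y0" "logistic q = z0" using logistic_surj assms by metis
  define c where "c = (p + q) / 2"
  define f where "f s w = logistic (c + s + w) - logistic (c + s - w)" for s w
  have cont: "continuous_on UNIV logistic"
    by (rule continuous_on_of_has_real_derivative) (rule logistic_has_derivative)
  have "\<exists>w. w 0 = (p - q) / 2 \<and> (\<forall>s. (w has_real_derivative f s (w s)) (at s))"
  proof (rule scalar_ode_solution_exists[where L = 2 and M = 2])
    show "continuous_on UNIV (\<lambda>z. f (fst z) (snd z))" unfolding f_def
      by (intro continuous_intros continuous_on_compose2[OF cont]) auto
    fix s v w
    show "\<bar>f s v - f s w\<bar> \<le> 2 * \<bar>v - w\<bar>"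
    proof -
      have "f s v - f s w = (logistic (c + s + v) - logistic (c + s + w)) - (logistic (c + s - v) - logistic (c + s - w))"
        by (simp add: f_def)
      also have "\<bar>\<dots>\<bar> \<le> \<bar>logistic (c + s + v) - logistic (c + s + w)\<bar> + \<bar>logistic (c + s - v) - logistic (c + s - w)\<bar>"
        by (rule abs_triangle_ineq4)
      also have "\<dots> \<le> \<bar>v - w\<bar> + \<bar>v - w\<bar>"
        using logistic_lipschitz[of "c + s + v" "c + s + w"] logistic_lipschitz[of "c + s - v" "c + s - w"]
        by (intro add_mono) (simp_all add: abs_minus_commute)
      finally show ?thesis by simp
    qed
    show "\<bar>f s w\<bar> \<le> 2"
      using logistic_gt_0[of "c + s + w"] logistic_lt_1[of "c + s + w"]
        logistic_gt_0[of "c + s - w"] logistic_lt_1[of "c + s - w"] unfolding f_def by linarith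
  qed simp
  then obtain w where w: "w 0 = (p - q) / 2" "\<And>s. (w has_real_derivative f s (w s)) (at s)" by blast
  define y where "y s = logistic (c + s + w s)" for s
  define z where "z s = logistic (c + s - w s)" for s
  have f: "f s (w s) = y s - z s" for s by (simp add: f_def y_def z_def)
  show ?thesis
  proof (rule that[of y z])
    have "c + 0 + w 0 = p" "c + 0 - w 0 = q" unfolding w(1) c_def by (simp_all add: field_simps)
    then show "y 0 = y0" "z 0 = z0" unfolding y_def z_def using pq by simp_all
    show "0 < y s" "y s < 1" "0 < z s" "z s < 1" for s
      by (simp_all add: y_def z_def logistic_gt_0 logistic_lt_1)
    have "((\<lambda>s. c + s + w s) has_real_derivative (1 + y s - z s)) (at s)" for s
      using w(2)[of s] f[of s] by (auto intro!: derivative_eq_intros)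
    from DERIV_chain2[OF logistic_has_derivative this]
    show "(y has_real_derivative y s * (1 - y s) * (1 + y s - z s)) (at s)" for s
      by (simp add: y_def[abs_def] z_def)
    have "((\<lambda>s. c + s - w s) has_real_derivative (1 + z s - y s)) (at s)" for s
      using w(2)[of s] f[of s] by (auto intro!: derivative_eq_intros)
    from DERIV_chain2[OF logistic_has_derivative this]
    show "(z has_real_derivative z s * (1 - z s) * (1 + z s - y s)) (at s)" for s
      by (simp add: z_def[abs_def] y_def)
  qed
qed

section \<open>Flow lines of left-invariant metrics up to extinction\<close>

text \<open>
  The size \<open>A = a$1\<close> is the integral of \<open>A' = - A * (1 - (y - z)^2) / 2\<close>. Since \<open>y\<close> and \<open>z\<close> increase within
  \<open>(0,1)\<close>, their difference stays away from 1 in absolute value, so \<open>A\<close> decays exponentially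
  and the original time \<open>\<tau> s\<close> has a finite limit \<open>T\<close>, at which the metric degenerates. Inverting \<open>\<tau>\<close> gives
  a solution of the flow on an open interval around \<open>[0,T)\<close>.

  For the lower bound on \<open>T\<close>: the rate of loss of \<open>A\<close> is at most \<open>A * (1 - y) + A * z\<close>. The second term is
  at most \<open>16 * \<tau>'\<close> and the first is at most \<open>2 * r * y'\<close>, because for \<open>y0 \<ge> 3/4\<close> the mismatch \<open>1 - y\<close>
  decays at a relative rate of at least 1/2. Hence \<open>A + 16 * \<tau> + 2 * r * y\<close> does not decrease, and comparing its values at \<open>s = 0\<close>
  and as \<open>s\<close> tends to infinity gives the claim.
\<close>

lemma left_ricci_flow_exists:
  fixes y0 z0 r :: real
  assumes y0: "0 < y0" "y0 < 1" and z0: "0 < z0" "z0 < 1" and r: "r > 0"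
  obtains T d :: real and a :: "real \<Rightarrow> real^3" where "d < 0" "0 < T"
    "a 0 = r *\<^sub>R vector [1, y0, z0]"
    "\<And>t. t \<in> {d<..<T} \<Longrightarrow> pos_weights (a t)"
    "\<And>t i. t \<in> {d<..<T} \<Longrightarrow> ((\<lambda>t. a t $ i) has_real_derivative - 2 * ricci_coeff (a t) $ i) (at t)"
    "((\<lambda>t. a t $ 1) \<longlongrightarrow> 0) (at_left T)"
    "3/4 \<le> y0 \<Longrightarrow> r * (2 * y0 - 1) / 16 \<le> T"
proof -
  obtain y z :: "real \<Rightarrow> real" where init: "y 0 = y0" "z 0 = z0"
    and yb: "\<And>s. 0 < y s" "\<And>s. y s < 1" and zb: "\<And>s. 0 < z s" "\<And>s. z s < 1"
    and yd: "\<And>s. (y has_real_derivative y s * (1 - y s) * (1 + y s - z s)) (at s)"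
    and zd: "\<And>s. (z has_real_derivative z s * (1 - z s) * (1 + z s - y s)) (at s)"
    using that by (rule shape_flow_exists[OF y0 z0])
  have cont: "continuous_on UNIV y" "continuous_on UNIV z"
    by (rule continuous_on_of_has_real_derivative, rule yd, rule continuous_on_of_has_real_derivative, rule zd)
  have "continuous_on UNIV (\<lambda>s. - (1 - (y s - z s)\<^sup>2) / 2)" by (intro continuous_intros cont) simp
  then obtain E where E: "E 0 = 0" "\<And>s. (E has_real_derivative - (1 - (y s - z s)\<^sup>2) / 2) (at s)"
    using antiderivative_exists by blast
  define A where "A s = r * exp (E s)" for s
  have A0: "A 0 = r" by (simp add: A_def E)
  have Apos: "A s > 0" for s using r by (simp add: A_def)
  have Ad: "(A has_real_derivative - A s * (1 - (y s - z s)\<^sup>2) / 2) (at s)" for s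
    unfolding A_def[abs_def] by (auto intro!: derivative_eq_intros E(2) simp: algebra_simps)
  have contA: "continuous_on UNIV A"
    by (rule continuous_on_of_has_real_derivative, rule Ad)
  have "continuous_on UNIV (\<lambda>s. A s * y s * z s / 8)" by (intro continuous_intros cont contA) simp
  then obtain \<tau> where \<tau>: "\<tau> 0 = 0" "\<And>s. (\<tau> has_real_derivative A s * y s * z s / 8) (at s)"
    using antiderivative_exists by blast
  have \<tau>': "A s * y s * z s / 8 > 0" for s using Apos yb zb by simp
  have \<tau>_less: "\<tau> s < \<tau> s'" if "s < s'" for s s'
  proof (rule DERIV_pos_imp_increasing[OF that])
    show "\<exists>D. (\<tau> has_real_derivative D) (at x) \<and> 0 < D" for x
      by (intro exI conjI, rule \<tau>(2), rule \<tau>')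
  qed
  have \<tau>_le: "\<tau> s \<le> \<tau> s'" if "s \<le> s'" for s s' using \<tau>_less[of s s'] that by (cases "s = s'") auto
  have \<tau>_less_iff: "\<tau> s < \<tau> s' \<longleftrightarrow> s < s'" for s s'
    using \<tau>_less \<tau>_le[of s' s] by (meson leD leI)
  have \<tau>_inj: "\<tau> s = \<tau> s' \<Longrightarrow> s = s'" for s s' using \<tau>_less_iff by (metis less_irrefl linorder_neqE)
  have \<tau>_cont: "isCont \<tau> s" for s using \<tau>(2) by (rule DERIV_isCont)

  \<comment> \<open>A lower bound, for \<open>s\<close> nonnegative, of the relative rate of decay of \<open>A\<close>, up to the factor 2.\<close>
  define m where "m = min y0 z0"
  have m: "0 < m" "m < 1" using y0 z0 by (auto simp: m_def)
  have mono: "y0 \<le> y s" "z0 \<le> z s" if s: "0 \<le> s" for s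
  proof -
    have "0 \<le> y s * (1 - y s) * (1 + y s - z s)" "0 \<le> z s * (1 - z s) * (1 + z s - y s)" for s
      using yb[of s] zb[of s] by simp_all
    from nondecreasing_of_deriv_nonneg[OF s yd this(1)] nondecreasing_of_deriv_nonneg[OF s zd this(2)]
    show "y0 \<le> y s" "z0 \<le> z s" unfolding init .
  qed
  have speed: "m \<le> 1 - (y s - z s)\<^sup>2" if s: "0 \<le> s" for s
  proof -
    have "\<bar>y s - z s\<bar> \<le> 1 - m" using mono[OF s] yb[of s] zb[of s] by (auto simp: m_def abs_le_iff)
    then have "(y s - z s)\<^sup>2 \<le> (1 - m)\<^sup>2" using m by (intro abs_le_square_iff[THEN iffD1]) auto
    also have "\<dots> \<le> 1 - m" using m by (simp add: power2_eq_square mult_le_cancel_left1 mult_left_le)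
    finally show ?thesis by simp
  qed
  have E_le: "E s \<le> - (m / 2) * s" if s: "0 \<le> s" for s
  proof -
    have "- (m / 2) * 0 - E 0 \<le> - (m / 2) * s - E s"
    proof (rule nondecreasing_of_deriv_nonneg[OF s, where f' = "\<lambda>s. - (m / 2) - - (1 - (y s - z s)\<^sup>2) / 2"])
      fix x :: real assume "0 \<le> x"
      show "((\<lambda>s. - (m / 2) * s - E s) has_real_derivative - (m / 2) - - (1 - (y x - z x)\<^sup>2) / 2) (at x)"
        by (rule derivative_eq_intros E(2) refl)+ simp
      show "0 \<le> - (m / 2) - - (1 - (y x - z x)\<^sup>2) / 2" using speed[OF \<open>0 \<le> x\<close>] by simp
    qed
    then show ?thesis using E(1) by simp
  qed
  have A_le: "A s \<le> r * exp (- (m / 2) * s)" if "0 \<le> s" for s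
    unfolding A_def using E_le[OF that] r by (intro mult_left_mono) auto
  have A_small: "\<exists>s\<ge>0. A s < \<epsilon>" if "\<epsilon> > 0" for \<epsilon>
  proof -
    define s where "s = max 0 (2 / m * ln (2 * r / \<epsilon>))"
    have s0: "0 \<le> s" by (simp add: s_def)
    have "m / 2 * (2 / m * ln (2 * r / \<epsilon>)) \<le> m / 2 * s" using m by (intro mult_left_mono) (auto simp: s_def)
    then have "- (m / 2) * s \<le> - ln (2 * r / \<epsilon>)" using m by simp
    then have "exp (- (m / 2) * s) \<le> exp (- ln (2 * r / \<epsilon>))" by simp
    also have "\<dots> = \<epsilon> / (2 * r)" using r that by (simp add: exp_minus)
    finally have "r * exp (- (m / 2) * s) \<le> r * (\<epsilon> / (2 * r))" using r by (intro mult_left_mono) auto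
    then have "A s \<le> \<epsilon> / 2" using A_le[OF s0] r by simp
    then show ?thesis using s0 that by (intro exI[of _ s]) auto
  qed
  have A_antimono: "A s' \<le> A s" if "s \<le> s'" for s s'
  proof -
    have "- A s \<le> - A s'"
    proof (rule nondecreasing_of_deriv_nonneg[OF that, where f' = "\<lambda>s. - (- A s * (1 - (y s - z s)\<^sup>2) / 2)"])
      show "((\<lambda>s. - A s) has_real_derivative - (- A x * (1 - (y x - z x)\<^sup>2) / 2)) (at x)" for x
        by (rule DERIV_minus[OF Ad])
      fix x :: real
      have "(y x - z x)\<^sup>2 \<le> 1"
        using yb[of x] zb[of x] by (intro abs_square_le_1[THEN iffD2]) (auto simp: abs_le_iff)
      then show "0 \<le> - (- A x * (1 - (y x - z x)\<^sup>2) / 2)" using Apos[of x] by simp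
    qed
    then show ?thesis by simp
  qed
  have \<tau>_bound: "\<tau> s \<le> r / (4 * m)" for s
  proof -
    have pos: "\<tau> s \<le> r / (4 * m)" if s: "0 \<le> s" for s
    proof -
      \<comment> \<open>Time passes at speed at most \<open>A / 8\<close>, while \<open>A / (4 * m)\<close> decreases at speed at least \<open>A / 8\<close>.\<close>
      have "- (\<tau> 0 + A 0 / (4 * m)) \<le> - (\<tau> s + A s / (4 * m))"
      proof (rule nondecreasing_of_deriv_nonneg[OF s,
          where f' = "\<lambda>x. - (A x * y x * z x / 8 + (- A x * (1 - (y x - z x)\<^sup>2) / 2) / (4 * m))"])
        fix x :: real assume x: "0 \<le> x"
        show "((\<lambda>s. - (\<tau> s + A s / (4 * m))) has_real_derivative
           - (A x * y x * z x / 8 + (- A x * (1 - (y x - z x)\<^sup>2) / 2) / (4 * m))) (at x)"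
          by (intro DERIV_minus DERIV_add \<tau>(2) DERIV_cdivide Ad)
        have "y x * z x \<le> 1 * 1" using yb[of x] zb[of x] by (intro mult_mono) auto
        also have "1 * 1 \<le> (1 - (y x - z x)\<^sup>2) / m" using speed[OF x] m by (simp add: le_divide_eq)
        finally have "A x / 8 * (y x * z x) \<le> A x / 8 * ((1 - (y x - z x)\<^sup>2) / m)"
          using Apos[of x] by (intro mult_left_mono) auto
        then show "0 \<le> - (A x * y x * z x / 8 + (- A x * (1 - (y x - z x)\<^sup>2) / 2) / (4 * m))"
          using m by (simp add: field_simps)
      qed
      moreover have "0 \<le> A s / (4 * m)" using Apos[of s] m by simp
      ultimately show ?thesis using \<tau>(1) A0 by simp
    qed
    show ?thesis using pos[of "max 0 s"] \<tau>_le[of s "max 0 s"] by simp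
  qed

  define T where "T = (SUP s. \<tau> s)"
  have bdd: "bdd_above (range \<tau>)" using \<tau>_bound by (auto intro!: bdd_aboveI)
  have \<tau>_T: "\<tau> s < T" for s
  proof -
    have "\<tau> s < \<tau> (s + 1)" by (rule \<tau>_less) simp
    also have "\<dots> \<le> T" unfolding T_def by (rule cSUP_upper[OF _ bdd]) simp
    finally show ?thesis .
  qed
  have T_approx: "\<exists>s. t < \<tau> s" if "t < T" for t
    using that unfolding T_def by (subst (asm) less_cSUP_iff[OF _ bdd]) auto
  have Tpos: "0 < T" using \<tau>_T[of 0] \<tau>(1) by simp
  \<comment> \<open>Any negative \<open>s\<close> would do: the solution must extend a little to negative times.\<close>
  define d where "d = \<tau> (-1)"
  have d: "d < 0" using \<tau>_less[of "-1" 0] by (simp add: d_def \<tau>(1))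
  define \<sigma> where "\<sigma> t = (THE s. \<tau> s = t)" for t
  have \<sigma>\<tau>: "\<sigma> (\<tau> s) = s" for s unfolding \<sigma>_def by (rule the_equality[OF refl \<tau>_inj])
  have surj: "\<exists>s. \<tau> s = t" if t: "t \<in> {d<..<T}" for t
  proof -
    obtain s where s: "t < \<tau> s" using T_approx t by auto
    have "-1 < s" using s t \<tau>_less_iff[of "-1" s] by (auto simp: d_def)
    then have "\<exists>x\<ge>-1. x \<le> s \<and> \<tau> x = t"
      using s t \<tau>_cont by (intro IVT) (auto simp: d_def)
    then show ?thesis by blast
  qed
  have \<tau>\<sigma>: "\<tau> (\<sigma> t) = t" if t: "t \<in> {d<..<T}" for t
  proof -
    obtain s where "\<tau> s = t" using surj[OF t] ..
    then show ?thesis using \<sigma>\<tau>[of s] by simp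
  qed
  have \<sigma>_cont: "isCont \<sigma> t" if t: "t \<in> {d<..<T}" for t
  proof -
    have "isCont \<sigma> (\<tau> (\<sigma> t))"
      by (rule isCont_inverse_function2[of "\<sigma> t - 1" _ "\<sigma> t + 1"]) (auto simp: \<sigma>\<tau> \<tau>_cont)
    then show ?thesis unfolding \<tau>\<sigma>[OF t] .
  qed
  have \<sigma>d: "(\<sigma> has_real_derivative inverse (A (\<sigma> t) * y (\<sigma> t) * z (\<sigma> t) / 8)) (at t)"
    if t: "t \<in> {d<..<T}" for t
    by (rule DERIV_inverse_function[where f = \<tau> and a = d and b = T, OF \<tau>(2)])
       (use t less_imp_neq[OF \<tau>'[of "\<sigma> t"]] \<tau>\<sigma> \<sigma>_cont[OF t] in simp_all)
  define a :: "real \<Rightarrow> real^3" where "a t = A (\<sigma> t) *\<^sub>R vector [1, y (\<sigma> t), z (\<sigma> t)]" for t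
  have a_nth: "a t $ 1 = A (\<sigma> t)" "a t $ 2 = A (\<sigma> t) * y (\<sigma> t)" "a t $ 3 = A (\<sigma> t) * z (\<sigma> t)" for t
    by (simp_all add: a_def)
  have pos: "pos_weights (a t)" for t
    unfolding pos_weights_def forall_3 a_nth using Apos yb zb by simp
  have ode: "((\<lambda>t. a t $ i) has_real_derivative - 2 * ricci_coeff (a t) $ i) (at t)"
    if t: "t \<in> {d<..<T}" for t i
  proof -
    define s where "s = \<sigma> t"
    have nz: "A s \<noteq> 0" "y s \<noteq> 0" "z s \<noteq> 0" using Apos[of s] yb(1)[of s] zb(1)[of s] by auto
    have d1: "((\<lambda>t. A (\<sigma> t)) has_real_derivative
        (- A s * (1 - (y s - z s)\<^sup>2) / 2) * inverse (A s * y s * z s / 8)) (at t)"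
      using DERIV_chain2[OF Ad \<sigma>d[OF t]] unfolding s_def .
    have d2: "((\<lambda>t. A (\<sigma> t) * y (\<sigma> t)) has_real_derivative
        ((- A s * (1 - (y s - z s)\<^sup>2) / 2) * y s + (y s * (1 - y s) * (1 + y s - z s)) * A s)
         * inverse (A s * y s * z s / 8)) (at t)"
      using DERIV_chain2[OF DERIV_mult[OF Ad yd] \<sigma>d[OF t]] unfolding s_def .
    have d3: "((\<lambda>t. A (\<sigma> t) * z (\<sigma> t)) has_real_derivative
        ((- A s * (1 - (y s - z s)\<^sup>2) / 2) * z s + (z s * (1 - z s) * (1 + z s - y s)) * A s)
         * inverse (A s * y s * z s / 8)) (at t)"
      using DERIV_chain2[OF DERIV_mult[OF Ad zd] \<sigma>d[OF t]] unfolding s_def .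
    have e1: "(- A s * (1 - (y s - z s)\<^sup>2) / 2) * inverse (A s * y s * z s / 8) = - 2 * ricci_coeff (a t) $ 1"
      unfolding ricci_coeff_nth a_nth s_def[symmetric] using nz by (simp add: divide_simps) algebra
    have e2: "((- A s * (1 - (y s - z s)\<^sup>2) / 2) * y s + (y s * (1 - y s) * (1 + y s - z s)) * A s)
         * inverse (A s * y s * z s / 8) = - 2 * ricci_coeff (a t) $ 2"
      unfolding ricci_coeff_nth a_nth s_def[symmetric] using nz by (simp add: divide_simps) algebra
    have e3: "((- A s * (1 - (y s - z s)\<^sup>2) / 2) * z s + (z s * (1 - z s) * (1 + z s - y s)) * A s)
         * inverse (A s * y s * z s / 8) = - 2 * ricci_coeff (a t) $ 3"
      unfolding ricci_coeff_nth a_nth s_def[symmetric] using nz by (simp add: divide_simps) algebra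
    consider "i = 1" | "i = 2" | "i = 3" using exhaust_3 by blast
    then show ?thesis
    proof cases
      case 1
      show ?thesis unfolding 1 e1[symmetric] unfolding a_nth by (rule d1)
    next
      case 2
      show ?thesis unfolding 2 e2[symmetric] unfolding a_nth by (rule d2)
    next
      case 3
      show ?thesis unfolding 3 e3[symmetric] unfolding a_nth by (rule d3)
    qed
  qed
  have lim: "((\<lambda>t. a t $ 1) \<longlongrightarrow> 0) (at_left T)"
  proof (rule tendstoI)
    fix \<epsilon> :: real assume "\<epsilon> > 0"
    then obtain s where s: "A s < \<epsilon>" "0 \<le> s" using A_small by blast
    show "\<forall>\<^sub>F t in at_left T. dist (a t $ 1) 0 < \<epsilon>"
      using eventually_at_left_real[OF \<tau>_T[of s]]
    proof eventually_elim
      case (elim t)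
      have "d < \<tau> s" unfolding d_def using s(2) by (intro \<tau>_less) simp
      then have "t \<in> {d<..<T}" using elim by simp
      then have "\<tau> s < \<tau> (\<sigma> t)" using elim \<tau>\<sigma> by simp
      then have "A (\<sigma> t) \<le> A s" using \<tau>_less_iff A_antimono by simp
      then show ?case using s(1) Apos[of "\<sigma> t"] by (simp add: a_nth)
    qed
  qed
  have lower: "r * (2 * y0 - 1) / 16 \<le> T" if y34: "3/4 \<le> y0"
  proof (rule field_le_epsilon)
    fix \<epsilon> :: real assume "0 < \<epsilon>"
    then obtain s where s: "0 \<le> s" "A s < \<epsilon>" using A_small by blast
    have "A 0 + 16 * \<tau> 0 + 2 * r * y 0 \<le> A s + 16 * \<tau> s + 2 * r * y s"
    proof (rule nondecreasing_of_deriv_nonneg[OF s(1), where f' = "\<lambda>x. - A x * (1 - (y x - z x)\<^sup>2) / 2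
        + 16 * (A x * y x * z x / 8) + 2 * r * (y x * (1 - y x) * (1 + y x - z x))"])
      fix x :: real assume x: "0 \<le> x"
      show "((\<lambda>s. A s + 16 * \<tau> s + 2 * r * y s) has_real_derivative - A x * (1 - (y x - z x)\<^sup>2) / 2
        + 16 * (A x * y x * z x / 8) + 2 * r * (y x * (1 - y x) * (1 + y x - z x))) (at x)"
        by (intro DERIV_add Ad DERIV_cmult \<tau>(2) yd)
      have yx: "3/4 \<le> y x" using mono(1)[OF x] y34 by simp
      have Ax: "A x \<le> r" using A_antimono[OF x] A0 by simp
      note b = yb[of x] zb[of x] Apos[of x]
      have "1 - (y x - z x)\<^sup>2 = ((1 - y x) + z x) * (1 + y x - z x)"
        by (simp add: power2_eq_square algebra_simps)
      also have "\<dots> \<le> ((1 - y x) + z x) * 2" using b by (intro mult_left_mono) auto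
      finally have "A x / 2 * (1 - (y x - z x)\<^sup>2) \<le> A x / 2 * (((1 - y x) + z x) * 2)"
        using b by (intro mult_left_mono) auto
      then have 1: "A x * (1 - (y x - z x)\<^sup>2) / 2 \<le> A x * (1 - y x) + A x * z x"
        by (simp only: times_divide_eq_left times_divide_eq_right distrib_left distrib_right nonzero_mult_div_cancel_right mult.assoc[symmetric])
      have 2: "A x * (1 - y x) \<le> r * (1 - y x)" using Ax b by (intro mult_right_mono) auto
      have "A x * z x * (1/2) \<le> A x * z x * y x" using b yx by (intro mult_left_mono) auto
      then have 3: "A x * z x \<le> 16 * (A x * y x * z x / 8)" by (simp add: ac_simps)
      have "(3/4) * (3/4) \<le> y x * (1 + y x - z x)" using b yx by (intro mult_mono) auto
      then have "r * (1 - y x) * (1/2) \<le> r * (1 - y x) * (y x * (1 + y x - z x))"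
        using b r by (intro mult_left_mono) auto
      then have 4: "r * (1 - y x) \<le> 2 * r * (y x * (1 - y x) * (1 + y x - z x))"
        by (simp only: ac_simps)
      show "0 \<le> - A x * (1 - (y x - z x)\<^sup>2) / 2
        + 16 * (A x * y x * z x / 8) + 2 * r * (y x * (1 - y x) * (1 + y x - z x))"
        using 1 2 3 4 by simp
    qed
    moreover have "2 * r * y s \<le> 2 * r * 1" using yb(2)[of s] r by (intro mult_left_mono) auto
    ultimately have "r * (2 * y0 - 1) \<le> 16 * T + \<epsilon>"
      using \<tau>_T[of s] s(2) A0 \<tau>(1) init(1) by (simp add: algebra_simps)
    then show "r * (2 * y0 - 1) / 16 \<le> T + \<epsilon>" using \<open>0 < \<epsilon>\<close> by simp
  qed
  have "a 0 = r *\<^sub>R vector [1, y0, z0]"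
    using \<sigma>\<tau>[of 0] unfolding a_def \<tau>(1) by (simp add: A0 init)
  from that[OF d Tpos this pos ode lim lower] show ?thesis .
qed

section \<open>Initial metrics with small positive scalar curvature\<close>

lemma scal_left_metric_pos:
  assumes a: "pos_weights a" and p: "p \<in> S3" and c: "(a$1 - a$2 + a$3)\<^sup>2 < 4 * a$1 * a$3"
  shows "scal (left_metric a) p > 0"
proof -
  note nz = pos_weightsD[OF a, of 1] pos_weightsD[OF a, of 2] pos_weightsD[OF a, of 3]
  have "scal (left_metric a) p = 2 * (4 * a$1 * a$3 - (a$1 - a$2 + a$3)\<^sup>2) / (a$1 * a$2 * a$3)"
    unfolding scal_left_metric[OF a p] sum_3 ricci_coeff_nth
    using nz by (simp add: divide_simps) algebra
  then show ?thesis using nz c by simp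
qed

text \<open>
  For squared lengths proportional to \<open>(1, 1 - e, e^2)\<close> the unscaled curvature norm is at least \<open>4 / e\<close>: the
  coefficient \<open>curv_coeff b $ 1\<close> is about \<open>-4 * e\<close>, and it is divided by the area factor
  \<open>b$2 * b$3\<close>, about \<open>e^2\<close>. The scalar curvature has the sign of \<open>4 * b$1 * b$3 - (b$1 - b$2 + b$3)^2\<close>,
  which is about \<open>4 * e^2 - e^2\<close>. Rescaling to unit curvature norm stretches the metric by \<open>r \<ge> 4 / e\<close>
  and with it the lower bound on the lifetime.
\<close>

lemma normalized_flow_exists:
  fixes e :: real
  assumes e: "0 < e" "e \<le> 1/4"
  obtains T :: real and g :: "real \<Rightarrow> metric" where
    "homogeneous_ricci_flow T g" "extinction_time g T"
    "\<forall>p\<in>S3. Rm_norm (g 0) p = 1" "\<forall>p\<in>S3. scal (g 0) p > 0" "1 / (8 * e) \<le> T"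
proof -
  define b :: "real^3" where "b = vector [1, 1 - e, e\<^sup>2]"
  have b: "b$1 = 1" "b$2 = 1 - e" "b$3 = e\<^sup>2" by (simp_all add: b_def)
  have bpos: "pos_weights b" unfolding pos_weights_def forall_3 b using e by simp
  define r where "r = curv_norm b"
  have r: "4 / e \<le> r"
  proof -
    have "(e + e\<^sup>2)\<^sup>2 = e * (e * (1 + e)\<^sup>2)" by (simp add: power2_eq_square algebra_simps)
    also have "\<dots> \<le> e * (1/4 * (5/4)\<^sup>2)"
      using e by (intro mult_left_mono mult_mono power_mono) auto
    also have "\<dots> \<le> 2 * e" using e by (simp add: power2_eq_square)
    finally have k: "2 * e \<le> 4 * e - (e + e\<^sup>2)\<^sup>2" by simp
    have \<kappa>: "curv_coeff b $ 1 * b$1 = - (4 * e - (e + e\<^sup>2)\<^sup>2)"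
      unfolding curv_coeff_nth b by (simp add: power2_eq_square algebra_simps)
    have "2 * e \<le> \<bar>curv_coeff b $ 1 * b$1\<bar>" unfolding \<kappa> using k by simp
    also have "\<dots> = sqrt ((curv_coeff b $ 1 * b$1)\<^sup>2)" by simp
    also have "\<dots> \<le> sqrt ((curv_coeff b $ 1 * b$1)\<^sup>2 + (curv_coeff b $ 2 * b$2)\<^sup>2 + (curv_coeff b $ 3 * b$3)\<^sup>2)"
      (is "_ \<le> sqrt ?K") by (intro real_sqrt_le_mono) (simp del: curv_coeff_nth)
    finally have K: "2 * e \<le> sqrt ?K" .
    have "4 / e = 2 * (2 * e) / e\<^sup>2" using e by (simp add: power2_eq_square)
    also have "\<dots> \<le> 2 * sqrt ?K / e\<^sup>2" using K e by (intro divide_right_mono) auto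
    also have "\<dots> \<le> 2 * sqrt ?K / (b$1 * b$2 * b$3)"
      using e K unfolding b by (intro divide_left_mono mult_pos_pos) (auto simp: mult_le_cancel_right1)
    finally show ?thesis unfolding r_def curv_norm_def .
  qed
  have rpos: "0 < r" using r e by (meson divide_pos_pos less_le_trans zero_less_numeral)
  have y0: "0 < 1 - e" "1 - e < 1" and z0: "0 < e\<^sup>2" "e\<^sup>2 < 1"
    using e by (simp_all add: power_less_one_iff)
  show ?thesis
  proof (rule left_ricci_flow_exists[OF y0 z0 rpos])
    fix T d :: real and a :: "real \<Rightarrow> real^3"
    assume d: "d < 0" and T: "0 < T" and a0: "a 0 = r *\<^sub>R vector [1, 1 - e, e\<^sup>2]"
      and pos: "\<And>t. t \<in> {d<..<T} \<Longrightarrow> pos_weights (a t)"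
      and ode: "\<And>t i. t \<in> {d<..<T} \<Longrightarrow> ((\<lambda>t. a t $ i) has_real_derivative - 2 * ricci_coeff (a t) $ i) (at t)"
      and lim: "((\<lambda>t. a t $ 1) \<longlongrightarrow> 0) (at_left T)"
      and lower: "3/4 \<le> 1 - e \<Longrightarrow> r * (2 * (1 - e) - 1) / 16 \<le> T"
    have a0: "a 0 = r *\<^sub>R b" unfolding a0 b_def ..
    have pos0: "pos_weights (a 0)" using pos d T by simp
    have flow: "ricci_flow T (\<lambda>t. left_metric (a t))"
      by (rule ricci_flow_left_metric[OF open_greaterThanLessThan _ pos ode]) (use d in auto)
    show ?thesis
    proof (rule that[of T "\<lambda>t. left_metric (a t)"])
      show "homogeneous_ricci_flow T (\<lambda>t. left_metric (a t))"
        unfolding homogeneous_ricci_flow_def using flow homogeneous_left_metric by blast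
      show "extinction_time (\<lambda>t. left_metric (a t)) T"
        by (rule extinction_time_left_metric[OF T flow lim])
      have "curv_norm (a 0) = 1"
        unfolding a0 curv_norm_scaleR[OF rpos bpos] r_def[symmetric] using rpos by simp
      then show "\<forall>p\<in>S3. Rm_norm (left_metric (a 0)) p = 1"
        using Rm_norm_left_metric[OF pos0] by metis
      have "(a 0$1 - a 0$2 + a 0$3)\<^sup>2 = (r * e)\<^sup>2 * (1 + e)\<^sup>2"
        unfolding a0 vector_scaleR_component b by (simp add: power2_eq_square algebra_simps)
      also have "\<dots> < (r * e)\<^sup>2 * 2\<^sup>2"
        using rpos e by (intro mult_strict_left_mono power_strict_mono) auto
      also have "\<dots> = 4 * a 0$1 * a 0$3"
        unfolding a0 vector_scaleR_component b by (simp add: power2_eq_square)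
      finally show "\<forall>p\<in>S3. scal (left_metric (a 0)) p > 0"
        using scal_left_metric_pos[OF pos0] by blast
      have "1 / (8 * e) = 4 / e * (1/2) / 16" by simp
      also have "\<dots> \<le> r * (2 * (1 - e) - 1) / 16"
        using r e rpos by (intro divide_right_mono mult_mono) auto
      also have "\<dots> \<le> T" using lower e by simp
      finally show "1 / (8 * e) \<le> T" .
    qed
  qed
qed

theorem lemma3p3:
  shows "\<exists>(g :: nat \<Rightarrow> real \<Rightarrow> metric) (T :: nat \<Rightarrow> real).
    (\<forall>l. homogeneous_ricci_flow (T l) (g l) \<and> extinction_time (g l) (T l) \<and>
         (\<forall>p\<in>S3. Rm_norm (g l 0) p = 1) \<and> (\<forall>p\<in>S3. scal (g l 0) p > 0)) \<and>
    filterlim T at_top sequentially"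
proof -
  let ?P = "\<lambda>(l::nat) (z :: (real \<Rightarrow> metric) \<times> real).
     homogeneous_ricci_flow (snd z) (fst z) \<and> extinction_time (fst z) (snd z) \<and>
     (\<forall>p\<in>S3. Rm_norm (fst z 0) p = 1) \<and> (\<forall>p\<in>S3. scal (fst z 0) p > 0) \<and> real l / 8 \<le> snd z"
  have "\<forall>l. \<exists>z. ?P l z"
  proof
    fix l
    show "\<exists>z. ?P l z"
    proof (rule normalized_flow_exists[of "1 / (real l + 4)"])
      fix T :: real and g :: "real \<Rightarrow> metric"
      assume g: "homogeneous_ricci_flow T g" "extinction_time g T"
        "\<forall>p\<in>S3. Rm_norm (g 0) p = 1" "\<forall>p\<in>S3. scal (g 0) p > 0" "1 / (8 * (1 / (real l + 4))) \<le> T"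
      have "real l / 8 \<le> T" using g(5) by simp
      then show ?thesis using g(1-4) by (intro exI[of _ "(g, T)"]) simp
    qed (auto simp: field_simps)
  qed
  from choice[OF this] obtain G where G: "\<forall>l. ?P l (G l)" ..
  have "filterlim (\<lambda>l. real l / 8) at_top sequentially"
    by (rule filterlim_at_top_mult_tendsto_pos[OF tendsto_const _ filterlim_real_sequentially, of "1/8", simplified])
  then have "filterlim (\<lambda>l. snd (G l)) at_top sequentially"
    by (rule filterlim_at_top_mono) (use G in auto)
  then show ?thesis using G by (intro exI[of _ "\<lambda>l. fst (G l)"] exI[of _ "\<lambda>l. snd (G l)"]) auto
qed

end
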